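(* Let $H$ be an apex-forest. Then every graph with tree-width at least $|V(H)|-1$ contains $H$ as a minor. In other words, $f(H)=|V(H)|-1$.
   Context: All graphs are finite and simple; the graph $H$ has at least one vertex. A graph is an apex-forest if it can be made a forest by deleting at most one vertex (every apex-forest is planar). A tree-decomposition of a graph $G$ is a pair $(T,\mathcal{X})$ where $T$ is a (non-empty) tree and $\mathcal{X}=(X_t : t\in V(T))$ is a collection of sets (called bags) such that: (i) $\bigcup_{t\in V(T)}X_t=V(G)$; (ii) for every $e\in E(G)$ there exists $t\in V(T)$ such that $X_t$ contains both ends of $e$; (iii) for every $v\in V(G)$, the set $\{t\in V(T): v\in X_t\}$ induces a connected subgraph of $T$. The width of $(T,\mathcal{X})$ is $\max_{t\in V(T)}|X_t|-1$. The tree-width of $G$ is the minimum width of a tree-decomposition of $G$. (The graph with no vertices is allowed as a graph and has tree-width $-1$.) A graph $G$ contains a graph $H$ as a minor if a graph isomorphic to $H$ can be obtained from $G$ by a sequence of vertex deletions, edge deletions, and edge contractions. For a planar graph $H$, $f(H)$ denotes the smallest integer such that every graph with tree-width at least $f(H)$ contains $H$ as a minor. *)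

theory Defs
  imports "Graph_Theory.Graph_Theory"
begin

text \<open>
  A finite simple graph is a term \<open>G\<close> with \<open>pair_graph G\<close>: a finite, loop-free, symmetric
  pair digraph, where the edge \<open>uv\<close> is the pair of arcs \<open>(u, v)\<close>, \<open>(v, u)\<close>.
  The null graph is allowed.

  The library predicates \<open>forest\<close> and \<open>tree\<close> cannot be used here: they count the closed
  walk \<open>u, v, u\<close> as a cycle, so a symmetric digraph satisfying \<open>forest\<close> has no edges at all.
  Undirected cycles are the cycles of length at least 3.
\<close>

definition undirected_forest :: "'a pair_pre_digraph \<Rightarrow> bool" where
  "undirected_forest G \<longleftrightarrow> pair_graph G \<and> \<not> (\<exists>p. pre_digraph.cycle (with_proj G) p \<and> 3 \<le> length p)"

text \<open>The library predicate \<open>connected\<close> includes non-emptiness, so trees are non-empty.\<close>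

definition undirected_tree :: "'a pair_pre_digraph \<Rightarrow> bool" where
  "undirected_tree T \<longleftrightarrow> undirected_forest T \<and> connected (with_proj T)"

definition delete_vertex :: "'a pair_pre_digraph \<Rightarrow> 'a \<Rightarrow> 'a pair_pre_digraph" where
  "delete_vertex G v =
    \<lparr>pverts = pverts G - {v}, parcs = {e \<in> parcs G. fst e \<noteq> v \<and> snd e \<noteq> v}\<rparr>"

definition delete_edge :: "'a pair_pre_digraph \<Rightarrow> 'a \<Rightarrow> 'a \<Rightarrow> 'a pair_pre_digraph" where
  "delete_edge G u v = \<lparr>pverts = pverts G, parcs = parcs G - {(u, v), (v, u)}\<rparr>"

text \<open>
  Contraction of the edge \<open>uv\<close>: the new vertex reuses the name \<open>u\<close>; the resulting loop is
  dropped, and parallel edges are merged since arcs form a set.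
\<close>

definition contract_edge :: "'a pair_pre_digraph \<Rightarrow> 'a \<Rightarrow> 'a \<Rightarrow> 'a pair_pre_digraph" where
  "contract_edge G u v =
    (let r = (\<lambda>x. if x = v then u else x)
     in \<lparr>pverts = pverts G - {v}, parcs = {(r x, r y) |x y. (x, y) \<in> parcs G \<and> r x \<noteq> r y}\<rparr>)"

inductive minor_step :: "'a pair_pre_digraph \<Rightarrow> 'a pair_pre_digraph \<Rightarrow> bool" where
  vertex_deletion: "v \<in> pverts G \<Longrightarrow> minor_step G (delete_vertex G v)"
| edge_deletion: "(u, v) \<in> parcs G \<Longrightarrow> minor_step G (delete_edge G u v)"
| edge_contraction: "(u, v) \<in> parcs G \<Longrightarrow> minor_step G (contract_edge G u v)"

definition has_minor :: "'a pair_pre_digraph \<Rightarrow> 'b pair_pre_digraph \<Rightarrow> bool" where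
  "has_minor G H \<longleftrightarrow> (\<exists>G'. minor_step\<^sup>*\<^sup>* G G' \<and> digraph_iso (with_proj H) (with_proj G'))"

definition apex_forest :: "'a pair_pre_digraph \<Rightarrow> bool" where
  "apex_forest H \<longleftrightarrow>
    undirected_forest H \<or> (\<exists>v \<in> pverts H. undirected_forest (delete_vertex H v))"

definition tree_decomposition ::
    "'a pair_pre_digraph \<Rightarrow> 't pair_pre_digraph \<Rightarrow> ('t \<Rightarrow> 'a set) \<Rightarrow> bool" where
  "tree_decomposition G T X \<longleftrightarrow>
    undirected_tree T \<and>
    (\<Union>t \<in> pverts T. X t) = pverts G \<and>
    (\<forall>(u, v) \<in> parcs G. \<exists>t \<in> pverts T. u \<in> X t \<and> v \<in> X t) \<and>
    (\<forall>v \<in> pverts G. connected (with_proj T \<restriction> {t \<in> pverts T. v \<in> X t}))"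

definition decomposition_width :: "'t pair_pre_digraph \<Rightarrow> ('t \<Rightarrow> 'a set) \<Rightarrow> int" where
  "decomposition_width T X = Max ((\<lambda>t. int (card (X t))) ` pverts T) - 1"

text \<open>
  Trees are finite, so taking their nodes from \<open>nat\<close> loses no generality. The width is an
  integer because the null graph has tree-width \<open>-1\<close>.
\<close>

definition treewidth :: "'a pair_pre_digraph \<Rightarrow> int" where
  "treewidth G =
    (LEAST w. \<exists>(T :: nat pair_pre_digraph) X.
       tree_decomposition G T X \<and> w = decomposition_width T X)"

text \<open>
  The number \<open>f(H)\<close>. Every finite graph is isomorphic to one with vertices in \<open>nat\<close>, so
  quantifying over these is quantifying over all graphs.
\<close>

definition minor_threshold :: "'a pair_pre_digraph \<Rightarrow> int" where
  "minor_threshold H =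
    (LEAST k. \<forall>G :: nat pair_pre_digraph. pair_graph G \<and> k \<le> treewidth G \<longrightarrow> has_minor G H)"


lemma with_proj_delete_vertex:
  "with_proj (delete_vertex G v) = pre_digraph.del_vert (with_proj G) v"
  by (auto simp: with_proj_def delete_vertex_def pre_digraph.del_vert_def)

lemma pair_graph_iff:
  "pair_graph G \<longleftrightarrow> finite (pverts G) \<and> parcs G \<subseteq> pverts G \<times> pverts G \<and> sym (parcs G) \<and> irrefl (parcs G)"
proof
  assume "pair_graph G"
  then interpret pair_graph G .
  show "finite (pverts G) \<and> parcs G \<subseteq> pverts G \<times> pverts G \<and> sym (parcs G) \<and> irrefl (parcs G)"
    using pair_finite_verts pair_sym_arcs
    by (auto simp: irrefl_def symmetric_def dest: in_arcsD1 in_arcsD2 pair_no_loops)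
next
  assume A: "finite (pverts G) \<and> parcs G \<subseteq> pverts G \<times> pverts G \<and> sym (parcs G) \<and> irrefl (parcs G)"
  then have "finite (parcs G)"
    by (meson finite_SigmaI finite_subset)
  with A show "pair_graph G"
    by unfold_locales (auto simp: irrefl_def symmetric_def)
qed

lemma pair_graph_minor_step:
  assumes "minor_step G G'" "pair_graph G"
  shows "pair_graph G'"
  using assms
proof cases
  case (vertex_deletion v)
  with assms(2) show ?thesis
    by (auto simp: pair_graph_iff delete_vertex_def sym_def irrefl_def)
next
  case (edge_deletion u v)
  with assms(2) show ?thesis
    by (auto simp: pair_graph_iff delete_edge_def sym_def irrefl_def)
next
  case (edge_contraction u v)
  with assms(2) have "u \<noteq> v" "u \<in> pverts G"
    by (auto simp: pair_graph_iff irrefl_def)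
  define r where "r = (\<lambda>x. if x = v then u else x)"
  have r: "r x \<in> pverts G - {v}" if "x \<in> pverts G" for x
    using that \<open>u \<noteq> v\<close> \<open>u \<in> pverts G\<close> by (auto simp: r_def)
  have G': "G' = \<lparr>pverts = pverts G - {v}, parcs = {(r x, r y) |x y. (x, y) \<in> parcs G \<and> r x \<noteq> r y}\<rparr>"
    using edge_contraction by (simp add: contract_edge_def r_def Let_def)
  have "finite (pverts G')" "irrefl (parcs G')"
    using assms(2) by (auto simp: G' pair_graph_iff irrefl_def)
  moreover have "sym (parcs G')"
  proof (rule symI)
    fix a b assume "(a, b) \<in> parcs G'"
    then obtain x y where "a = r x" "b = r y" "(x, y) \<in> parcs G" "r x \<noteq> r y"
      by (auto simp: G')
    moreover from this have "(y, x) \<in> parcs G"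
      using assms(2) by (simp add: pair_graph_iff sym_def)
    ultimately show "(b, a) \<in> parcs G'"
      unfolding G' by (simp, metis)
  qed
  moreover have "parcs G' \<subseteq> pverts G' \<times> pverts G'"
    using assms(2) r by (fastforce simp: G' pair_graph_iff)
  ultimately show ?thesis
    by (simp add: pair_graph_iff)
qed

end

theory Submission
  imports Defs
begin

text \<open>
  Let \<open>a\<close> be the apex of \<open>H\<close>, so that \<open>F = H - a\<close> is a forest, and let \<open>w\<close> be the number of its
  vertices. A graph of tree-width at least \<open>w\<close> has a bramble that no set of at most \<open>w\<close> vertices
  covers; this is the hard half of tree-width duality (\<open>bramble_admissible_td\<close>, after the proof
  in Diestel's book). Call a connected vertex set large if it contains an element of this
  bramble. It suffices to find a large set \<open>C\<close> with exactly \<open>w\<close> neighbours and a model of \<open>F\<close>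
  outside \<open>C\<close> each of whose branch sets contains a neighbour of \<open>C\<close>: then \<open>C\<close> is a branch set
  for \<open>a\<close>, however \<open>a\<close> is joined to \<open>F\<close>.

  Such a model grows vertex by vertex, in an order in which each vertex of \<open>F\<close> has at most one
  earlier neighbour (\<open>attached_model_exists\<close>). With \<open>k\<close> vertices modelled, \<open>C\<close> has \<open>k\<close>
  neighbours and no large subset of \<open>C\<close> has fewer than \<open>k\<close>; choose \<open>C\<close> smallest with this
  property. Let \<open>v\<close> be the next vertex, and \<open>y\<close> a vertex of \<open>C\<close> next to the branch set that \<open>v\<close>
  has to touch. Since the neighbours of \<open>C\<close> together with \<open>y\<close> do not cover the bramble, some
  large \<open>C1\<close> inside \<open>C - y\<close> has only these as neighbours. If every large subset of \<open>C - y\<close> has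
  more than \<open>k\<close> neighbours, then \<open>C1\<close> has all of these \<open>k + 1\<close> neighbours, and \<open>{y}\<close> is a branch
  set for \<open>v\<close>. Otherwise some large \<open>C'\<close> inside \<open>C - y\<close> has \<open>k\<close> neighbours. A separator of fewer
  than \<open>k\<close> vertices between the neighbourhoods of \<open>C\<close> and \<open>C'\<close> would contain the neighbourhood
  of a large subset of \<open>C\<close>, so by Menger's theorem there are \<open>k\<close> disjoint paths between them;
  prolonging the branch sets along these paths replaces \<open>C\<close> by \<open>C'\<close>, contrary to the choice of
  \<open>C\<close>.

  The bound is attained: the complete graph on \<open>|V(H)| - 1\<close> vertices has too few vertices to
  contain \<open>H\<close>, and its tree-width is at least \<open>|V(H)| - 2\<close> because pairwise intersecting
  subtrees of a tree have a common node (\<open>subtrees_helly\<close>).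

  The graph theory is done with a symmetric relation \<open>E\<close> as the edge set. Connected vertex sets
  take the place of paths, also in Menger's theorem: disjoint connected sets are all that branch
  sets and separation arguments need.
\<close>

section \<open>Connected vertex sets\<close>

definition connected_in :: "'a rel \<Rightarrow> 'a set \<Rightarrow> bool" where
  "connected_in E P \<longleftrightarrow> P \<noteq> {} \<and> (\<forall>u\<in>P. \<forall>v\<in>P. (u, v) \<in> rtrancl_on P E)"

text \<open>
  A nonempty part of a connected set that no edge leaves is everything. Together with the
  converse \<open>connected_inI\<close> this replaces most inductions along paths.
\<close>

lemma connected_in_subset:
  assumes "connected_in E P" "a \<in> P" "a \<in> Q"
    and "\<And>u v. u \<in> P \<Longrightarrow> u \<in> Q \<Longrightarrow> v \<in> P \<Longrightarrow> (u, v) \<in> E \<Longrightarrow> v \<in> Q"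
  shows "P \<subseteq> Q"
proof
  fix b assume "b \<in> P"
  with assms(1,2) have "(a, b) \<in> rtrancl_on P E" by (auto simp: connected_in_def)
  then show "b \<in> Q"
  proof (induct rule: rtrancl_on_induct)
    case base
    show ?case by (rule assms(3))
  next
    case (step y z)
    show ?case by (rule assms(4)[OF step(3,5,4,2)])
  qed
qed

lemma connected_inI:
  assumes "P \<noteq> {}"
    and "\<And>a Q. a \<in> P \<Longrightarrow> a \<in> Q \<Longrightarrow> Q \<subseteq> P \<Longrightarrow> (\<And>u v. u \<in> Q \<Longrightarrow> v \<in> P \<Longrightarrow> (u, v) \<in> E \<Longrightarrow> v \<in> Q) \<Longrightarrow> P \<subseteq> Q"
  shows "connected_in E P"
proof -
  have "(a, b) \<in> rtrancl_on P E" if "a \<in> P" "b \<in> P" for a b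
  proof -
    have "P \<subseteq> {v. (a, v) \<in> rtrancl_on P E}"
      by (rule assms(2)[of a]) (use that in \<open>auto dest: in_rtrancl_on_in_F intro: rtrancl_on_into_rtrancl_on\<close>)
    with that show ?thesis by auto
  qed
  with assms(1) show ?thesis by (auto simp: connected_in_def)
qed

lemma connected_in_nonempty: "connected_in E P \<Longrightarrow> P \<noteq> {}"
  by (simp add: connected_in_def)

lemma connected_in_singleton: "connected_in E {a}"
  by (simp add: connected_in_def)

lemma connected_in_mono: "connected_in E P \<Longrightarrow> E \<subseteq> E' \<Longrightarrow> connected_in E' P"
  unfolding connected_in_def by (meson rtrancl_on_mono subsetD order_refl)

lemma connected_in_restrict:
  assumes "connected_in E P" "P \<subseteq> D"
  shows "connected_in (E \<inter> D \<times> D) P"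
proof (rule connected_inI)
  show "P \<noteq> {}" using assms(1) by (rule connected_in_nonempty)
next
  fix a Q assume a: "a \<in> P" "a \<in> Q" "\<And>u v. u \<in> Q \<Longrightarrow> v \<in> P \<Longrightarrow> (u, v) \<in> E \<inter> D \<times> D \<Longrightarrow> v \<in> Q"
  show "P \<subseteq> Q"
    by (rule connected_in_subset[OF assms(1) a(1,2)]) (use a(3) assms(2) in auto)
qed

lemma connected_in_domain:
  assumes "connected_in (E \<inter> D \<times> D) P" "a \<in> P" "a \<in> D"
  shows "P \<subseteq> D"
  by (rule connected_in_subset[OF assms(1,2,3)]) auto

lemma connected_in_Un:
  assumes "sym E" "connected_in E P" "connected_in E Q"
    and "P \<inter> Q \<noteq> {} \<or> (\<exists>p\<in>P. \<exists>q\<in>Q. (p, q) \<in> E)"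
  shows "connected_in E (P \<union> Q)"
proof (rule connected_inI)
  show "P \<union> Q \<noteq> {}" using connected_in_nonempty[OF assms(2)] by auto
next
  fix a S assume a: "a \<in> P \<union> Q" "a \<in> S"
    and S: "\<And>u v. u \<in> S \<Longrightarrow> v \<in> P \<union> Q \<Longrightarrow> (u, v) \<in> E \<Longrightarrow> v \<in> S"
  have P: "P \<subseteq> S" if "b \<in> P" "b \<in> S" for b
    by (rule connected_in_subset[OF assms(2) that]) (use S in auto)
  have Q: "Q \<subseteq> S" if "b \<in> Q" "b \<in> S" for b
    by (rule connected_in_subset[OF assms(3) that]) (use S in auto)
  have "P \<inter> S \<noteq> {} \<longleftrightarrow> Q \<inter> S \<noteq> {}"
  proof (cases "P \<inter> Q = {}")
    case True
    then obtain p q where "p \<in> P" "q \<in> Q" "(p, q) \<in> E" using assms(4) by auto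
    moreover from this have "(q, p) \<in> E" using assms(1) by (simp add: symD)
    ultimately show ?thesis using P Q S by blast
  next
    case False
    then show ?thesis using P Q by blast
  qed
  then show "P \<union> Q \<subseteq> S" using a P Q by blast
qed

lemma connected_in_UN:
  assumes "sym E" "connected_in E P" "\<And>i. i \<in> I \<Longrightarrow> connected_in E (Q i)" "\<And>i. i \<in> I \<Longrightarrow> P \<inter> Q i \<noteq> {}"
  shows "connected_in E (P \<union> (\<Union>i\<in>I. Q i))"
proof (rule connected_inI)
  show "P \<union> (\<Union>i\<in>I. Q i) \<noteq> {}" using connected_in_nonempty[OF assms(2)] by auto
next
  fix a S assume a: "a \<in> P \<union> (\<Union>i\<in>I. Q i)" "a \<in> S"
    and S: "\<And>u v. u \<in> S \<Longrightarrow> v \<in> P \<union> (\<Union>i\<in>I. Q i) \<Longrightarrow> (u, v) \<in> E \<Longrightarrow> v \<in> S"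
  have P: "P \<subseteq> S" if "b \<in> P" "b \<in> S" for b
    by (rule connected_in_subset[OF assms(2) that]) (use S in auto)
  have Q: "Q i \<subseteq> S" if "i \<in> I" "b \<in> Q i" "b \<in> S" for b i
    by (rule connected_in_subset[OF assms(3)[OF that(1)] that(2,3)]) (use S that in auto)
  have "P \<subseteq> S" using a P Q assms(4) by blast
  then show "P \<union> (\<Union>i\<in>I. Q i) \<subseteq> S" using Q assms(4) by blast
qed

lemma connected_in_reachable:
  assumes "sym E" "a \<in> D"
  shows "connected_in E {v. (a, v) \<in> rtrancl_on D E}" (is "connected_in E ?R")
proof (rule connected_inI)
  show "?R \<noteq> {}" using assms(2) by auto
next
  fix b S assume b: "b \<in> ?R" "b \<in> S" and S: "\<And>u v. u \<in> S \<Longrightarrow> v \<in> ?R \<Longrightarrow> (u, v) \<in> E \<Longrightarrow> v \<in> S"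
  have "(a, b) \<in> rtrancl_on D E" using b by auto
  then have "a \<in> S" using b(2)
  proof (induct rule: rtrancl_on_induct)
    case (step y z)
    then show ?case using S[of z y] assms(1) by (auto dest: symD)
  qed
  show "?R \<subseteq> S"
  proof
    fix v assume "v \<in> ?R"
    then have "(a, v) \<in> rtrancl_on D E" by simp
    then show "v \<in> S"
      by (induct rule: rtrancl_on_induct)
        (use \<open>a \<in> S\<close> S in \<open>auto intro: rtrancl_on_into_rtrancl_on\<close>)
  qed
qed

section \<open>Menger's theorem\<close>

text \<open>
  The separators of \<open>A\<close> and \<open>B\<close>. Phrased with connected sets in place of paths, the notion
  agrees with the way in which covers of a bramble are used.
\<close>

definition hits :: "'a rel \<Rightarrow> 'a set \<Rightarrow> 'a set \<Rightarrow> 'a set \<Rightarrow> bool" where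
  "hits E A B S \<longleftrightarrow> (\<forall>P. connected_in E P \<longrightarrow> P \<inter> A \<noteq> {} \<longrightarrow> P \<inter> B \<noteq> {} \<longrightarrow> P \<inter> S \<noteq> {})"

text \<open>
  As many disjoint sets as elements of \<open>X\<close>, all meeting \<open>X\<close>, meet it in one element each. This
  is how families ending in a separator of the right size are glued.
\<close>

lemma anchored_family:
  assumes "finite X" "finite I" "card I = card X" "disjoint_family_on P I"
    "\<And>i. i \<in> I \<Longrightarrow> P i \<inter> X \<noteq> {}"
  obtains g where "bij_betw g X I" "\<And>x. x \<in> X \<Longrightarrow> x \<in> P (g x)"
proof -
  define h where "h i = (SOME x. x \<in> P i \<inter> X)" for i
  have h: "h i \<in> P i \<inter> X" if "i \<in> I" for i
    unfolding h_def by (rule someI_ex) (use assms(5)[OF that] in auto)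
  have inj: "inj_on h I"
  proof (rule inj_onI)
    fix i j assume "i \<in> I" "j \<in> I" "h i = h j"
    with h[of i] h[of j] assms(4) show "i = j"
      by (auto simp: disjoint_family_on_def)
  qed
  have "h ` I = X"
    by (rule card_subset_eq) (use assms h card_image[OF inj] in auto)
  with inj have bij: "bij_betw h I X" by (simp add: bij_betw_def)
  show ?thesis
  proof
    show "bij_betw (the_inv_into I h) X I" using bij by (rule bij_betw_the_inv_into)
    fix x assume "x \<in> X"
    then obtain i where "i \<in> I" "h i = x" using \<open>h ` I = X\<close> by auto
    then show "x \<in> P (the_inv_into I h x)" using inj h by (auto simp: the_inv_into_f_f)
  qed
qed

text \<open>
  The union of those components of the graph without \<open>S\<close> that meet \<open>Z\<close>.
\<close>

definition side :: "'a rel \<Rightarrow> 'a set \<Rightarrow> 'a set \<Rightarrow> 'a set" where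
  "side E S Z = {v. \<exists>Q. connected_in E Q \<and> Q \<inter> Z \<noteq> {} \<and> v \<in> Q \<and> Q \<inter> S = {}}"

lemma side_disjoint: "side E S Z \<inter> S = {}"
  by (auto simp: side_def)

lemma subset_side: "Z \<subseteq> side E S Z \<union> S"
  using connected_in_singleton[of E] by (fastforce simp: side_def)

lemma side_step:
  assumes "sym E" and u: "u \<in> side E S Z" "(u, v) \<in> E" "v \<notin> S"
  shows "v \<in> side E S Z"
proof -
  obtain R where R: "connected_in E R" "R \<inter> Z \<noteq> {}" "u \<in> R" "R \<inter> S = {}"
    using u(1) unfolding side_def by blast
  have "connected_in E (R \<union> {v})"
    by (rule connected_in_Un[OF assms(1) R(1) connected_in_singleton]) (use R u in auto)
  moreover have "(R \<union> {v}) \<inter> Z \<noteq> {}" "v \<in> R \<union> {v}" "(R \<union> {v}) \<inter> S = {}" using R u by auto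
  ultimately show ?thesis unfolding side_def by blast
qed

text \<open>
  Let \<open>S\<close> separate \<open>A\<close> from \<open>B\<close> once the edge \<open>xy\<close> is removed, with \<open>x\<close> on the side of \<open>A\<close>. A
  connected set from \<open>A\<close> to \<open>B\<close> has to leave the side of \<open>A\<close> through \<open>S\<close> or through \<open>x\<close>, and up
  to that point it lives on this side and does not use \<open>xy\<close>. So a separator of \<open>A\<close> from \<open>S + x\<close>
  there separates \<open>A\<close> from \<open>B\<close> in the whole graph.
\<close>

lemma menger_one_side:
  assumes "sym E" and xy: "(x, y) \<in> E" "E' = E - {(x, y), (y, x)}"
    and L: "L = side E' S A" and "x \<in> L" "y \<notin> L" "L \<inter> B = {}"
    and T: "hits (E' \<inter> (L \<union> S) \<times> (L \<union> S)) A (insert x S) T"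
  shows "hits E A B T"
  unfolding hits_def
proof (intro allI impI)
  fix P assume P: "connected_in E P" "P \<inter> A \<noteq> {}" "P \<inter> B \<noteq> {}"
  let ?E = "E' \<inter> (L \<union> S) \<times> (L \<union> S)"
  have symE': "sym E'" using assms(1) xy(2) by (auto simp: sym_def)
  then have sym: "sym ?E" by (auto simp: sym_def)
  obtain a where a: "a \<in> P" "a \<in> A" using P by auto
  define Q where "Q = {v. (a, v) \<in> rtrancl_on P ?E}"
  have Q: "connected_in ?E Q" unfolding Q_def by (rule connected_in_reachable[OF sym a(1)])
  have QP: "Q \<subseteq> P" "a \<in> Q" using a by (auto simp: Q_def dest: in_rtrancl_on_in_F)
  have AL: "a \<in> L \<union> S" unfolding L using a subset_side by fast
  show "P \<inter> T \<noteq> {}"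
  proof (cases "Q \<inter> insert x S = {}")
    case False
    then have "Q \<inter> T \<noteq> {}" using T Q QP(2) a(2) by (auto simp: hits_def)
    then show ?thesis using QP(1) by auto
  next
    case True
    have Q_sub: "Q \<subseteq> L"
      using connected_in_domain[OF Q QP(2) AL] True by auto
    have L_step: "v \<in> L \<union> S" if "u \<in> L" "(u, v) \<in> E'" for u v
      using side_step[OF symE'] that unfolding L by auto
    have "P \<subseteq> Q"
    proof (rule connected_in_subset[OF P(1) a(1) QP(2)])
      fix u v assume uv: "u \<in> P" "u \<in> Q" "v \<in> P" "(u, v) \<in> E"
      have "u \<noteq> x" "u \<noteq> y" "u \<in> L" using True uv(2) Q_sub \<open>y \<notin> L\<close> by auto
      then have "(u, v) \<in> E'" using uv(4) xy(2) by auto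
      then have "(u, v) \<in> ?E" using L_step[of u v] \<open>u \<in> L\<close> by auto
      then show "v \<in> Q" using uv unfolding Q_def by (auto intro: rtrancl_on_into_rtrancl_on)
    qed
    then show ?thesis using P(3) Q_sub \<open>L \<inter> B = {}\<close> by auto
  qed
qed

text \<open>
  Induction on the number of edges. If deleting an edge \<open>xy\<close> creates a separator \<open>S\<close> with fewer
  than \<open>k\<close> vertices, then \<open>x\<close> and \<open>y\<close> lie on different sides of \<open>S\<close>, and \<open>S + x\<close> and \<open>S + y\<close> are
  separators of the whole graph, of size exactly \<open>k\<close>. The induction hypothesis applied to each
  side gives \<open>k\<close> disjoint connected sets from \<open>A\<close> to \<open>S + x\<close> and from \<open>S + y\<close> to \<open>B\<close>; they are
  glued at the vertices of \<open>S\<close> and along the edge \<open>xy\<close>. The index set is taken from the vertices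
  because \<open>S + x\<close> is the natural one in the last step.
\<close>

theorem menger:
  fixes E :: "'a rel"
  assumes "finite E" "sym E" "irrefl E" "finite A" "finite B"
    and "\<And>S. finite S \<Longrightarrow> hits E A B S \<Longrightarrow> k \<le> card S"
  shows "\<exists>(I :: 'a set) P. finite I \<and> card I = k \<and> disjoint_family_on P I \<and>
           (\<forall>i\<in>I. connected_in E (P i) \<and> P i \<inter> A \<noteq> {} \<and> P i \<inter> B \<noteq> {})"
  using assms
proof (induct "card E" arbitrary: E A B rule: less_induct)
  case (less E A B)
  note sym = less.prems(2)
  show ?case
  proof (cases "E = {}")
    case True
    have "P \<inter> (A \<inter> B) \<noteq> {}" if P: "connected_in E P" "P \<inter> A \<noteq> {}" "P \<inter> B \<noteq> {}" for P
    proof -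
      obtain a where a: "a \<in> P" "a \<in> A" using P by auto
      have "P \<subseteq> {a}" by (rule connected_in_subset[OF P(1) a(1)]) (use True in auto)
      then show ?thesis using P a by auto
    qed
    then have "k \<le> card (A \<inter> B)" using less.prems by (auto simp: hits_def)
    then obtain I where "I \<subseteq> A \<inter> B" "card I = k" "finite I"
      by (rule obtain_subset_with_card_n)
    then show ?thesis
      by (intro exI[of _ I] exI[of _ "\<lambda>i. {i}"])
        (auto simp: disjoint_family_on_def connected_in_singleton)
  next
    case False
    then obtain x0 y0 where xy0: "(x0, y0) \<in> E" by auto
    define E' where "E' = E - {(x0, y0), (y0, x0)}"
    have E': "finite E'" "sym E'" "irrefl E'" "E' \<subseteq> E"
      using less.prems by (auto simp: E'_def sym_def irrefl_def)
    have less_card: "card F < card E" if "F \<subseteq> E'" for F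
      by (rule psubset_card_mono) (use that less.prems(1) xy0 E'_def in auto)
    show ?thesis
    proof (cases "\<forall>S. finite S \<longrightarrow> hits E' A B S \<longrightarrow> k \<le> card S")
      case True
      then obtain I :: "'a set" and P where "finite I" "card I = k" "disjoint_family_on P I"
        "\<forall>i\<in>I. connected_in E' (P i) \<and> P i \<inter> A \<noteq> {} \<and> P i \<inter> B \<noteq> {}"
        using less.hyps[OF less_card[OF order_refl] E'(1-3) less.prems(4,5)] by auto
      then show ?thesis using connected_in_mono[OF _ E'(4)] by (intro exI[of _ I] exI[of _ P]) auto
    next
      case False
      then obtain S where S: "finite S" "hits E' A B S" "card S < k" by auto
      then have "\<not> hits E A B S" using less.prems(6)[of S] by auto
      then obtain P0 where P0: "connected_in E P0" "P0 \<inter> A \<noteq> {}" "P0 \<inter> B \<noteq> {}" "P0 \<inter> S = {}"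
        by (auto simp: hits_def)
      define sd where "sd = side E' S"
      note sd = side_disjoint[of E' S, folded sd_def] subset_side[of _ E' S, folded sd_def]
        side_step[OF E'(2), of _ S, folded sd_def]
      have disj: "sd A \<inter> sd B = {}"
      proof (rule ccontr)
        assume "sd A \<inter> sd B \<noteq> {}"
        then obtain v Q R where
          Q: "connected_in E' Q" "Q \<inter> A \<noteq> {}" "v \<in> Q" "Q \<inter> S = {}" and
          R: "connected_in E' R" "R \<inter> B \<noteq> {}" "v \<in> R" "R \<inter> S = {}"
          unfolding sd_def side_def by blast
        have "connected_in E' (Q \<union> R)"
          by (rule connected_in_Un[OF E'(2) Q(1) R(1)]) (use Q R in auto)
        then show False using S(2) Q R unfolding hits_def by (metis Int_Un_distrib2 Un_empty)
      qed
      \<comment> \<open>the connected set \<open>P0\<close> avoids \<open>S\<close>, so it can leave a side only by the deleted edge\<close>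
      have crossing: "\<exists>u v. u \<in> sd Z \<and> v \<notin> sd Z \<and> (u, v) \<in> {(x0, y0), (y0, x0)}"
        if Z: "P0 \<inter> Z \<noteq> {}" "P0 \<inter> Z' \<noteq> {}" "sd Z \<inter> sd Z' = {}" for Z Z'
      proof (rule ccontr)
        assume *: "\<not> ?thesis"
        obtain z where z: "z \<in> P0" "z \<in> Z" using Z by auto
        have "P0 \<subseteq> sd Z"
        proof (rule connected_in_subset[OF P0(1) z(1)])
          show "z \<in> sd Z" using z sd(2)[of Z] P0(4) by auto
          fix u v assume uv: "u \<in> P0" "u \<in> sd Z" "v \<in> P0" "(u, v) \<in> E"
          show "v \<in> sd Z"
          proof (cases "(u, v) \<in> {(x0, y0), (y0, x0)}")
            case True
            then show ?thesis using * uv by blast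
          next
            case False
            then show ?thesis using sd(3)[OF uv(2), of v] uv P0(4) by (auto simp: E'_def)
          qed
        qed
        then show False using Z(2,3) sd(2)[of Z'] P0(4) by blast
      qed
      obtain x y where x: "x \<in> sd A" "y \<notin> sd A" and xy: "(x, y) \<in> {(x0, y0), (y0, x0)}"
        using crossing[OF P0(2,3) disj] by blast
      obtain u v where uv: "u \<in> sd B" "v \<notin> sd B" "(u, v) \<in> {(x0, y0), (y0, x0)}"
        using crossing[of B A] P0(2,3) disj by blast
      have y: "y \<in> sd B" "x \<notin> sd B" using x uv xy disj by auto
      have xyE: "(x, y) \<in> E" "(y, x) \<in> E" "E' = E - {(x, y), (y, x)}" "E' = E - {(y, x), (x, y)}"
        using xy xy0 sym by (auto simp: E'_def dest: symD)
      let ?EA = "E' \<inter> (sd A \<union> S) \<times> (sd A \<union> S)" and ?EB = "E' \<inter> (sd B \<union> S) \<times> (sd B \<union> S)"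
      have fin: "finite (insert x S)" "finite (insert y S)" using S(1) by auto
      have EA: "finite ?EA" "sym ?EA" "irrefl ?EA" and EB: "finite ?EB" "sym ?EB" "irrefl ?EB"
        using E' by (auto simp: sym_def irrefl_def)
      have AB: "sd A \<inter> B = {}" "sd B \<inter> A = {}"
        using disj sd(2)[of A] sd(2)[of B] sd(1) by blast+
      have *: "\<exists>(I :: 'a set) P. finite I \<and> card I = k \<and> disjoint_family_on P I \<and>
           (\<forall>i\<in>I. connected_in ?EA (P i) \<and> P i \<inter> A \<noteq> {} \<and> P i \<inter> insert x S \<noteq> {})"
      proof (rule less.hyps[OF less_card EA less.prems(4) fin(1)])
        fix T assume "finite T" "hits ?EA A (insert x S) T"
        then show "k \<le> card T"
          using menger_one_side[OF sym xyE(1,3) sd_def[THEN fun_cong] x AB(1)] less.prems(6) by blast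
      qed auto
      then obtain I :: "'a set" and P where IP: "finite I" "card I = k" "disjoint_family_on P I"
        "\<And>i. i \<in> I \<Longrightarrow> connected_in ?EA (P i) \<and> P i \<inter> A \<noteq> {} \<and> P i \<inter> insert x S \<noteq> {}" by blast
      have *: "\<exists>(J :: 'a set) Q. finite J \<and> card J = k \<and> disjoint_family_on Q J \<and>
           (\<forall>i\<in>J. connected_in ?EB (Q i) \<and> Q i \<inter> B \<noteq> {} \<and> Q i \<inter> insert y S \<noteq> {})"
      proof (rule less.hyps[OF less_card EB less.prems(5) fin(2)])
        fix T assume "finite T" "hits ?EB B (insert y S) T"
        then have "hits E B A T"
          using menger_one_side[OF sym xyE(2,4) sd_def[THEN fun_cong] y AB(2)] by blast
        then have "hits E A B T" by (auto simp: hits_def)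
        then show "k \<le> card T" using less.prems(6) \<open>finite T\<close> by blast
      qed auto
      then obtain J :: "'a set" and Q where JQ: "finite J" "card J = k" "disjoint_family_on Q J"
        "\<And>i. i \<in> J \<Longrightarrow> connected_in ?EB (Q i) \<and> Q i \<inter> B \<noteq> {} \<and> Q i \<inter> insert y S \<noteq> {}" by blast
      have xS: "x \<notin> S" "y \<notin> S" using x y sd(1) by blast+
      have k: "k = Suc (card S)"
      proof -
        have "k \<le> card (insert x S)"
        proof (rule less.prems(6)[OF fin(1)])
          show "hits E A B (insert x S)"
            by (rule menger_one_side[OF sym xyE(1,3) sd_def[THEN fun_cong] x AB(1)]) (auto simp: hits_def)
        qed
        then show ?thesis using S(1,3) xS by simp
      qed
      obtain f where f: "bij_betw f (insert x S) I" "\<And>z. z \<in> insert x S \<Longrightarrow> z \<in> P (f z)"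
        by (rule anchored_family[OF fin(1) IP(1) _ IP(3)]) (use IP k xS S in auto)
      obtain g where g: "bij_betw g (insert y S) J" "\<And>z. z \<in> insert y S \<Longrightarrow> z \<in> Q (g z)"
        by (rule anchored_family[OF fin(2) JQ(1) _ JQ(3)]) (use JQ k xS S in auto)
      have fI: "f z \<in> I" if "z \<in> insert x S" for z using f(1) that by (rule bij_betwE[rule_format])
      have gJ: "g z \<in> J" if "z \<in> insert y S" for z using g(1) that by (rule bij_betwE[rule_format])
      have P_sub: "P (f z) \<subseteq> sd A \<union> S" if "z \<in> insert x S" for z
        using connected_in_domain[of E' "sd A \<union> S" "P (f z)" z] IP(4)[OF fI[OF that]] f(2)[OF that] that x by auto
      have Q_sub: "Q (g z) \<subseteq> sd B \<union> S" if "z \<in> insert y S" for z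
        using connected_in_domain[of E' "sd B \<union> S" "Q (g z)" z] JQ(4)[OF gJ[OF that]] g(2)[OF that] that y by auto
      have P_disj: "z = z'" if "z \<in> insert x S" "z' \<in> insert x S" "w \<in> P (f z)" "w \<in> P (f z')" for z z' w
        using that f(1) fI IP(3) unfolding disjoint_family_on_def bij_betw_def inj_on_def by blast
      have Q_disj: "z = z'" if "z \<in> insert y S" "z' \<in> insert y S" "w \<in> Q (g z)" "w \<in> Q (g z')" for z z' w
        using that g(1) gJ JQ(3) unfolding disjoint_family_on_def bij_betw_def inj_on_def by blast
      \<comment> \<open>the set through \<open>z\<close> on the side of \<open>A\<close> continues on the other side through \<open>r z\<close>\<close>
      define r where "r z = (if z = x then y else z)" for z
      have r: "r z \<in> insert y S" if "z \<in> insert x S" for z using that by (auto simp: r_def)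
      have r_inj: "z = z'" if "r z = r z'" "z \<in> insert x S" "z' \<in> insert x S" for z z'
        using that xS by (auto simp: r_def split: if_splits)
      define W where "W z = P (f z) \<union> Q (g (r z))" for z
      have PQ: "z = z'" if "z \<in> insert x S" "z' \<in> insert x S" "w \<in> P (f z)" "w \<in> Q (g (r z'))" for z z' w
      proof -
        have "w \<in> S" using P_sub[OF that(1)] Q_sub[OF r[OF that(2)]] that(3,4) disj sd(1) by blast
        then have "w = z" "w = r z'" using P_disj[of w z w] Q_disj[of w "r z'" w] f(2)[of w] g(2)[of w] that r by auto
        then show ?thesis using \<open>w \<in> S\<close> xS by (auto simp: r_def split: if_splits)
      qed
      have "disjoint_family_on W (insert x S)"
        unfolding disjoint_family_on_def W_def
      proof (intro ballI impI, rule ccontr)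
        fix z z' assume z: "z \<in> insert x S" "z' \<in> insert x S" "z \<noteq> z'"
          "(P (f z) \<union> Q (g (r z))) \<inter> (P (f z') \<union> Q (g (r z'))) \<noteq> {}"
        then obtain w where "w \<in> P (f z) \<union> Q (g (r z))" "w \<in> P (f z') \<union> Q (g (r z'))" by blast
        then show False using z(1-3) P_disj[of z z' w] PQ[of z z' w] PQ[of z' z w]
            Q_disj[OF r r, of z z' w] r_inj[of z z'] by blast
      qed
      moreover have "connected_in E (W z) \<and> W z \<inter> A \<noteq> {} \<and> W z \<inter> B \<noteq> {}" if "z \<in> insert x S" for z
      proof -
        have 1: "connected_in E (P (f z))" "connected_in E (Q (g (r z)))"
          using IP(4)[OF fI[OF that]] JQ(4)[OF gJ[OF r[OF that]]] E'(4) by (auto elim!: connected_in_mono)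
        have "P (f z) \<inter> Q (g (r z)) \<noteq> {} \<or> (\<exists>p\<in>P (f z). \<exists>q\<in>Q (g (r z)). (p, q) \<in> E)"
          using f(2)[OF that] g(2)[OF r[OF that]] xyE(1) by (cases "z = x") (auto simp: r_def)
        then have "connected_in E (W z)" unfolding W_def by (rule connected_in_Un[OF sym 1])
        then show ?thesis unfolding W_def using IP(4)[OF fI[OF that]] JQ(4)[OF gJ[OF r[OF that]]] by blast
      qed
      ultimately show ?thesis using fin(1) k xS S(1) by (intro exI[of _ "insert x S"] exI[of _ W]) auto
    qed
  qed
qed

text \<open>
  The form in which Menger's theorem is applied: \<open>A\<close> itself is a smallest separator, so one of
  the disjoint connected sets starts in each vertex of \<open>A\<close>.
\<close>

corollary menger_from:
  fixes E :: "'a rel"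
  assumes "finite E" "sym E" "irrefl E" "finite A" "finite B"
    and "\<And>S. finite S \<Longrightarrow> hits E A B S \<Longrightarrow> card A \<le> card S"
  obtains P where "disjoint_family_on P A"
    "\<And>a. a \<in> A \<Longrightarrow> a \<in> P a \<and> connected_in E (P a) \<and> P a \<inter> B \<noteq> {}"
proof -
  have "\<exists>(I :: 'a set) P. finite I \<and> card I = card A \<and> disjoint_family_on P I \<and>
      (\<forall>i\<in>I. connected_in E (P i) \<and> P i \<inter> A \<noteq> {} \<and> P i \<inter> B \<noteq> {})"
    by (rule menger[OF assms])
  then obtain I :: "'a set" and P where IP: "finite I" "card I = card A" "disjoint_family_on P I"
    "\<And>i. i \<in> I \<Longrightarrow> connected_in E (P i) \<and> P i \<inter> A \<noteq> {} \<and> P i \<inter> B \<noteq> {}"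
    by blast
  obtain g where g: "bij_betw g A I" "\<And>z. z \<in> A \<Longrightarrow> z \<in> P (g z)"
    by (rule anchored_family[OF assms(4) IP(1,2,3)]) (use IP(4) in auto)
  show ?thesis
  proof
    show "disjoint_family_on (P \<circ> g) A"
      unfolding disjoint_family_on_def
    proof (intro ballI impI)
      fix a b assume "a \<in> A" "b \<in> A" "a \<noteq> b"
      then have "g a \<in> I" "g b \<in> I" "g a \<noteq> g b"
        using g(1) by (auto simp: bij_betw_def inj_on_def)
      then show "(P \<circ> g) a \<inter> (P \<circ> g) b = {}"
        using IP(3) by (simp add: disjoint_family_on_def)
    qed
    fix a assume "a \<in> A"
    then show "a \<in> (P \<circ> g) a \<and> connected_in E ((P \<circ> g) a) \<and> (P \<circ> g) a \<inter> B \<noteq> {}"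
      using g(2) IP(4) bij_betwE[OF g(1)] by auto
  qed
qed

section \<open>Rooted tree-decompositions\<close>

definition neighbourhood :: "'a rel \<Rightarrow> 'a set \<Rightarrow> 'a set" where
  "neighbourhood E C = {v. v \<notin> C \<and> (\<exists>c\<in>C. (c, v) \<in> E)}"

text \<open>
  \<open>rooted_td E U R \<R>\<close> holds if the graph induced on \<open>U\<close> has a tree-decomposition with set of
  bags \<open>\<R>\<close> whose root has bag \<open>R\<close>. Joining makes the second root a child of the first; the
  side conditions say that the two parts overlap only in both root bags and that no edge runs
  between them elsewhere. The tree itself stays implicit and is rebuilt only in
  \<open>rooted_td_realise\<close>.
\<close>

inductive rooted_td :: "'a rel \<Rightarrow> 'a set \<Rightarrow> 'a set \<Rightarrow> 'a set set \<Rightarrow> bool" for E where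
  single: "rooted_td E R R {R}"
| join: "rooted_td E U1 R1 \<R>1 \<Longrightarrow> rooted_td E U2 R2 \<R>2 \<Longrightarrow> U1 \<inter> U2 \<subseteq> R1 \<inter> R2 \<Longrightarrow>
    \<forall>x\<in>U1 - U2. \<forall>y\<in>U2 - U1. (x, y) \<notin> E \<Longrightarrow> rooted_td E (U1 \<union> U2) R1 (\<R>1 \<union> \<R>2)"

lemma rooted_td_root: "rooted_td E U R \<R> \<Longrightarrow> R \<in> \<R>"
  by (induct rule: rooted_td.induct) auto

lemma rooted_td_bag_subset: "rooted_td E U R \<R> \<Longrightarrow> Q \<in> \<R> \<Longrightarrow> Q \<subseteq> U"
  by (induct arbitrary: Q rule: rooted_td.induct) auto

lemma rooted_td_attach:
  assumes "sym E" "rooted_td E U1 Z \<R>1" "Q \<in> \<R>1" "rooted_td E U2 R2 \<R>2"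
    and "U1 \<inter> U2 \<subseteq> Q \<inter> R2" "\<forall>x\<in>U1 - U2. \<forall>y\<in>U2 - U1. (x, y) \<notin> E"
  shows "rooted_td E (U1 \<union> U2) Z (\<R>1 \<union> \<R>2)"
  using assms(2,3,5,6)
proof (induct rule: rooted_td.induct)
  case (single R)
  then show ?case using rooted_td.join[OF rooted_td.single assms(4), of R] by simp
next
  case (join Ua Ra \<R>a Ub Rb \<R>b)
  note sub = rooted_td_bag_subset[OF join(1)] rooted_td_bag_subset[OF join(3)]
  have no_edge: "(y, x) \<notin> E" if "x \<in> (Ua \<union> Ub) - U2" "y \<in> U2 - (Ua \<union> Ub)" for x y
    using join(9) that assms(1) by (meson symD)
  show ?case
  proof (cases "Q \<in> \<R>a")
    case True
    then have Q: "Q \<subseteq> Ua" by (rule sub)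
    have "rooted_td E (Ua \<union> U2) Ra (\<R>a \<union> \<R>2)"
    proof (rule join(2)[OF True])
      show "Ua \<inter> U2 \<subseteq> Q \<inter> R2" using join(8) by auto
      show "\<forall>x\<in>Ua - U2. \<forall>y\<in>U2 - Ua. (x, y) \<notin> E"
        using join(8,9) Q by blast
    qed
    then have "rooted_td E ((Ua \<union> U2) \<union> Ub) Ra ((\<R>a \<union> \<R>2) \<union> \<R>b)"
    proof (rule rooted_td.join[OF _ join(3)])
      show "(Ua \<union> U2) \<inter> Ub \<subseteq> Ra \<inter> Rb" using join(5,8) Q by blast
      show "\<forall>x\<in>Ua \<union> U2 - Ub. \<forall>y\<in>Ub - (Ua \<union> U2). (x, y) \<notin> E"
        using join(6) no_edge by blast
    qed
    then show ?thesis by (simp add: Un_ac)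
  next
    case False
    then have Qb: "Q \<in> \<R>b" using join(7) by auto
    then have Q: "Q \<subseteq> Ub" by (rule sub)
    have "rooted_td E (Ub \<union> U2) Rb (\<R>b \<union> \<R>2)"
    proof (rule join(4)[OF Qb])
      show "Ub \<inter> U2 \<subseteq> Q \<inter> R2" using join(8) by auto
      show "\<forall>x\<in>Ub - U2. \<forall>y\<in>U2 - Ub. (x, y) \<notin> E"
        using join(8,9) Q by blast
    qed
    then have "rooted_td E (Ua \<union> (Ub \<union> U2)) Ra (\<R>a \<union> (\<R>b \<union> \<R>2))"
    proof (rule rooted_td.join[OF join(1)])
      show "Ua \<inter> (Ub \<union> U2) \<subseteq> Ra \<inter> Rb" using join(5,8) Q by blast
      show "\<forall>x\<in>Ua - (Ub \<union> U2). \<forall>y\<in>Ub \<union> U2 - Ua. (x, y) \<notin> E"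
        using join(6,9) by blast
    qed
    then show ?thesis by (simp add: Un_ac)
  qed
qed

lemma rooted_td_reroot:
  assumes "sym E" "rooted_td E U R \<R>" "Z \<in> \<R>"
  shows "rooted_td E U Z \<R>"
  using assms(2,3)
proof (induct rule: rooted_td.induct)
  case (single R)
  then show ?case using rooted_td.single by auto
next
  case (join Ua Ra \<R>a Ub Rb \<R>b)
  show ?case
  proof (cases "Z \<in> \<R>a")
    case True
    show ?thesis
      by (rule rooted_td_attach[OF assms(1) join(2)[OF True] rooted_td_root[OF join(1)] join(3,5,6)])
  next
    case False
    then have "rooted_td E Ub Z \<R>b" using join by auto
    then have "rooted_td E (Ub \<union> Ua) Z (\<R>b \<union> \<R>a)"
      by (rule rooted_td_attach[OF assms(1) _ rooted_td_root[OF join(3)] join(1)])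
        (use join(5,6) assms(1) in \<open>auto dest: symD\<close>)
    then show ?thesis by (simp add: Un_ac)
  qed
qed

section \<open>Brambles\<close>

text \<open>
  Two connected sets touch if they meet or are joined by an edge; for connected sets this means
  that their union is connected.
\<close>

definition bramble :: "'a set \<Rightarrow> 'a rel \<Rightarrow> 'a set set \<Rightarrow> bool" where
  "bramble V E \<B> \<longleftrightarrow> (\<forall>B\<in>\<B>. B \<subseteq> V \<and> connected_in E B) \<and> (\<forall>B\<in>\<B>. \<forall>B'\<in>\<B>. connected_in E (B \<union> B'))"

definition covers :: "'a set \<Rightarrow> 'a set set \<Rightarrow> bool" where
  "covers X \<B> \<longleftrightarrow> (\<forall>B\<in>\<B>. B \<inter> X \<noteq> {})"

definition admissible :: "nat \<Rightarrow> 'a set set \<Rightarrow> 'a set \<Rightarrow> bool" where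
  "admissible w \<B> Q \<longleftrightarrow> card Q \<le> w \<or> \<not> covers Q \<B>"

text \<open>
  A connected set that has a vertex in a subtree with root bag \<open>R\<close> and meets the bag \<open>Z\<close>, which
  lies outside this subtree or is its root bag, cannot avoid \<open>R\<close>.
\<close>

lemma root_bag_separates:
  assumes "E \<subseteq> V \<times> V" "\<And>u v. u \<in> U - R \<Longrightarrow> v \<in> V - U \<Longrightarrow> (u, v) \<notin> E" "Z \<inter> (U - R) = {}"
    and "connected_in E Q" "x \<in> Q" "x \<in> U" "Q \<inter> Z \<noteq> {}"
  shows "Q \<inter> R \<noteq> {}"
proof
  assume QR: "Q \<inter> R = {}"
  have "Q \<subseteq> U - R"
  proof (rule connected_in_subset[OF assms(4,5)])
    show "x \<in> U - R" using assms(5,6) QR by auto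
    fix u v assume uv: "u \<in> Q" "u \<in> U - R" "v \<in> Q" "(u, v) \<in> E"
    then have "v \<in> V" using assms(1) by auto
    then show "v \<in> U - R" using assms(2)[OF uv(2), of v] uv QR by auto
  qed
  then show False using assms(3,7) by auto
qed

text \<open>
  In the contraction of a tree-decomposition onto \<open>X\<close> and \<open>C\<close>, a bag \<open>R\<close> keeps its part in \<open>C\<close>
  and receives those \<open>x\<close> in \<open>X\<close> that occur at or below \<open>R\<close>. For such \<open>x\<close> the set \<open>P x\<close> runs from
  below \<open>R\<close> to \<open>Z\<close>, so it meets \<open>R\<close>: the new bag is no larger than \<open>R\<close>. For the same reason an
  element of the bramble that avoids \<open>R\<close> has no vertex at or below \<open>R\<close>, so it avoids the new bag
  as well.
\<close>

lemma contracted_bag_admissible: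
  assumes E: "E \<subseteq> V \<times> V"
    and X: "finite X" "card X \<le> w"
    and P: "disjoint_family_on P X" "\<And>x. x \<in> X \<Longrightarrow> x \<in> P x \<and> connected_in E (P x) \<and> P x \<inter> Z \<noteq> {} \<and> P x \<inter> C = {}"
    and \<B>: "\<And>B. B \<in> \<B> \<Longrightarrow> connected_in E B \<and> B \<inter> Z \<noteq> {}"
    and sep: "\<And>u v. u \<in> U - R \<Longrightarrow> v \<in> V - U \<Longrightarrow> (u, v) \<notin> E" "Z \<inter> (U - R) = {}"
    and R: "R \<subseteq> U" "finite R" "admissible w (insert C \<B>) R"
  shows "admissible w \<B> ((X \<inter> U) \<union> (R \<inter> C))"
proof -
  let ?W = "(X \<inter> U) \<union> (R \<inter> C)"
  have XC: "X \<inter> C = {}" using P(2) by blast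
  show ?thesis
  proof (cases "card ?W \<le> w")
    case True
    then show ?thesis by (simp add: admissible_def)
  next
    case False
    have meets: "P x \<inter> R \<noteq> {}" if "x \<in> X \<inter> U" for x
      by (rule root_bag_separates[OF E sep, of _ x]) (use P(2)[of x] that in auto)
    define h where "h x = (SOME v. v \<in> P x \<inter> R)" for x
    have h: "h x \<in> P x \<inter> R" if "x \<in> X \<inter> U" for x
      unfolding h_def by (rule someI_ex) (use meets[OF that] in auto)
    have "card (X \<inter> U) \<le> card (R - C)"
    proof (rule card_inj_on_le[of h])
      show "inj_on h (X \<inter> U)"
      proof (rule inj_onI)
        fix x y assume "x \<in> X \<inter> U" "y \<in> X \<inter> U" "h x = h y"
        with h[of x] h[of y] P(1) show "x = y" by (auto simp: disjoint_family_on_def)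
      qed
      show "h ` (X \<inter> U) \<subseteq> R - C" using h P(2) by blast
    qed (use R in auto)
    moreover have "card ?W \<le> card (X \<inter> U) + card (R \<inter> C)" by (rule card_Un_le)
    moreover have "card R = card (R - C) + card (R \<inter> C)"
      using R(2) by (metis add.commute card_Int_Diff)
    ultimately have "w < card R" using False by linarith
    then obtain B where B: "B \<in> insert C \<B>" "B \<inter> R = {}"
      using R(3) by (auto simp: admissible_def covers_def)
    have "B \<noteq> C"
    proof
      assume "B = C"
      then have "?W \<subseteq> X" using B by auto
      then have "card ?W \<le> w" using X card_mono[of X ?W] by linarith
      with False show False by simp
    qed
    then have B\<B>: "B \<in> \<B>" using B by auto
    have "B \<inter> U = {}"
      using root_bag_separates[OF E sep, of B] \<B>[OF B\<B>] B(2) by blast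
    then have "B \<inter> ?W = {}" using R(1) by auto
    then show ?thesis using B\<B> by (auto simp: admissible_def covers_def)
  qed
qed

text \<open>
  The subtree below a node is decomposed by recursion; \<open>U\<close> is the set of vertices at or below
  the node and \<open>R\<close> its bag. The hypotheses on \<open>U\<close> say that \<open>R\<close> separates \<open>U\<close> from the remaining
  graph and from \<open>Z\<close>; they hold trivially for a tree with root bag \<open>Z\<close>, where the result has
  root bag \<open>X\<close>.
\<close>

lemma rooted_td_contract:
  assumes E: "E \<subseteq> V \<times> V" "sym E" "finite V"
    and X: "X \<subseteq> V" "card X \<le> w"
    and P: "disjoint_family_on P X" "\<And>x. x \<in> X \<Longrightarrow> x \<in> P x \<and> connected_in E (P x) \<and> P x \<inter> Z \<noteq> {} \<and> P x \<inter> C = {}"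
    and \<B>: "\<And>B. B \<in> \<B> \<Longrightarrow> connected_in E B \<and> B \<inter> Z \<noteq> {}"
    and td: "rooted_td E U R \<R>" "U \<subseteq> V"
      "\<forall>u\<in>U - R. \<forall>v\<in>V - U. (u, v) \<notin> E" "Z \<inter> (U - R) = {}"
      "\<forall>Q\<in>\<R>. admissible w (insert C \<B>) Q"
  shows "\<exists>\<R>'. rooted_td E (U \<inter> (X \<union> C)) ((X \<inter> U) \<union> (R \<inter> C)) \<R>' \<and> (\<forall>Q\<in>\<R>'. admissible w \<B> Q)"
  using td
proof (induct rule: rooted_td.induct)
  case (single R)
  have "finite X" "finite R" using X(1) E(3) single(1) by (auto intro: finite_subset)
  then have "admissible w \<B> ((X \<inter> R) \<union> (R \<inter> C))"
    using single by (intro contracted_bag_admissible[OF E(1) _ X(2) P \<B>]) auto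
  moreover have "R \<inter> (X \<union> C) = (X \<inter> R) \<union> (R \<inter> C)" by auto
  ultimately show ?case using rooted_td.single[of E "(X \<inter> R) \<union> (R \<inter> C)"] by auto
next
  case (join U1 R1 \<R>1 U2 R2 \<R>2)
  note sub = rooted_td_bag_subset[OF join(1) rooted_td_root[OF join(1)]]
    rooted_td_bag_subset[OF join(3) rooted_td_root[OF join(3)]]
  have fin: "finite X" "finite R1" using X(1) E(3) join(7) sub by (meson finite_subset Un_subset_iff)+
  have edge12: "(x, y) \<notin> E" "(y, x) \<notin> E" if "x \<in> U1 - U2" "y \<in> U2 - U1" for x y
    using join(6) that E(2) by (auto dest: symD)
  let ?D = "X \<union> C"
  let ?W = "(X \<inter> (U1 \<union> U2)) \<union> (R1 \<inter> C)"
  let ?W1 = "(X \<inter> U1) \<union> (R1 \<inter> C)" and ?W2 = "(X \<inter> U2) \<union> (R2 \<inter> C)"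
  have "\<exists>\<R>'. rooted_td E (U1 \<inter> ?D) ?W1 \<R>' \<and> (\<forall>Q\<in>\<R>'. admissible w \<B> Q)"
  proof (rule join(2))
    show "\<forall>u\<in>U1 - R1. \<forall>v\<in>V - U1. (u, v) \<notin> E"
      using join(5,8) edge12 by blast
  qed (use join(7,9,10) in auto)
  then obtain \<R>1' where td1: "rooted_td E (U1 \<inter> ?D) ?W1 \<R>1'" "\<forall>Q\<in>\<R>1'. admissible w \<B> Q" by blast
  have "\<exists>\<R>'. rooted_td E (U2 \<inter> ?D) ?W2 \<R>' \<and> (\<forall>Q\<in>\<R>'. admissible w \<B> Q)"
  proof (rule join(4))
    show "\<forall>u\<in>U2 - R2. \<forall>v\<in>V - U2. (u, v) \<notin> E"
      using join(5,8) edge12 sub by blast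
    show "Z \<inter> (U2 - R2) = {}" using join(5,9) sub by blast
  qed (use join(7,10) in auto)
  then obtain \<R>2' where td2: "rooted_td E (U2 \<inter> ?D) ?W2 \<R>2'" "\<forall>Q\<in>\<R>2'. admissible w \<B> Q" by blast
  have W: "admissible w \<B> ?W"
    using join(7-10) sub fin rooted_td_root[OF join(1)]
    by (intro contracted_bag_admissible[OF E(1) _ X(2) P \<B>]) auto
  \<comment> \<open>the bag \<open>?W\<close> of the joined tree may be larger than \<open>?W1\<close>, so it becomes a new root above both parts\<close>
  have "rooted_td E (?W \<union> (U1 \<inter> ?D)) ?W ({?W} \<union> \<R>1')"
  proof (rule rooted_td.join[OF rooted_td.single td1(1)])
    show "?W \<inter> (U1 \<inter> ?D) \<subseteq> ?W \<inter> ?W1" by auto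
    show "\<forall>x\<in>?W - U1 \<inter> ?D. \<forall>y\<in>U1 \<inter> ?D - ?W. (x, y) \<notin> E"
    proof (intro ballI)
      fix x y assume xy: "x \<in> ?W - U1 \<inter> ?D" "y \<in> U1 \<inter> ?D - ?W"
      then have "x \<in> U2 - U1" "y \<in> U1 - U2" using join(5) sub by auto
      then show "(x, y) \<notin> E" using edge12 by blast
    qed
  qed
  then have "rooted_td E ((?W \<union> (U1 \<inter> ?D)) \<union> (U2 \<inter> ?D)) ?W (({?W} \<union> \<R>1') \<union> \<R>2')"
  proof (rule rooted_td.join[OF _ td2(1)])
    show "(?W \<union> (U1 \<inter> ?D)) \<inter> (U2 \<inter> ?D) \<subseteq> ?W \<inter> ?W2" using join(5) sub by auto
    show "\<forall>x\<in>(?W \<union> (U1 \<inter> ?D)) - U2 \<inter> ?D. \<forall>y\<in>U2 \<inter> ?D - (?W \<union> (U1 \<inter> ?D)). (x, y) \<notin> E"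
    proof (intro ballI)
      fix x y assume xy: "x \<in> (?W \<union> (U1 \<inter> ?D)) - U2 \<inter> ?D" "y \<in> U2 \<inter> ?D - (?W \<union> (U1 \<inter> ?D))"
      then have "x \<in> U1 - U2" "y \<in> U2 - U1" using sub by auto
      then show "(x, y) \<notin> E" using edge12 by blast
    qed
  qed
  moreover have "(?W \<union> (U1 \<inter> ?D)) \<union> (U2 \<inter> ?D) = (U1 \<union> U2) \<inter> ?D" using sub by auto
  ultimately show ?case using td1(2) td2(2) W by auto
qed

text \<open>
  If every bramble has a cover of size at most \<open>w\<close>, then for each bramble there is a
  tree-decomposition in which every bag that covers the bramble is small; for the empty bramble
  this bounds all bags.

  The proof adds sets to the bramble as long as possible. Take a smallest cover \<open>X\<close>. It is
  enough to decompose \<open>X\<close> together with one component \<open>C\<close> of the rest, with root bag \<open>X\<close>, and to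
  glue the results at \<open>X\<close>. If \<open>C\<close> does not touch some element of the bramble, then \<open>C\<close> with its
  neighbours is a bag that misses this element. Otherwise \<open>C\<close> can be added to the bramble, and
  by induction there is a decomposition that is admissible for the larger bramble. If it is not
  admissible for the smaller one, then some bag \<open>Z\<close> with more than \<open>w\<close> vertices covers
  everything but \<open>C\<close>. Every separator of \<open>X\<close> and \<open>Z\<close> covers the bramble and has therefore at
  least as many vertices as \<open>X\<close>, so \<open>X\<close> is linked to \<open>Z\<close>, and contraction onto \<open>X\<close> along the
  linkage (\<open>rooted_td_contract\<close>) gives the decomposition of \<open>X\<close> and \<open>C\<close>.
\<close>

theorem bramble_admissible_td:
  fixes V :: "'a set"
  assumes V: "finite V" "E \<subseteq> V \<times> V" "sym E" "irrefl E"
    and cover: "\<And>\<B>. bramble V E \<B> \<Longrightarrow> \<exists>X\<subseteq>V. card X \<le> w \<and> covers X \<B>"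
    and "bramble V E \<B>"
  shows "\<exists>R \<R>. rooted_td E V R \<R> \<and> (\<forall>Q\<in>\<R>. admissible w \<B> Q)"
  using assms(6)
proof (induct "card (Pow V - \<B>)" arbitrary: \<B> rule: less_induct)
  case (less \<B>)
  show ?case
  proof (rule ccontr)
    assume none: "\<not> ?thesis"
    have finE: "finite E" using V(1,2) finite_subset by auto
    obtain X0 where X0: "X0 \<subseteq> V" "card X0 \<le> w" "covers X0 \<B>" using cover[OF less.prems] by blast
    then obtain X where "X \<subseteq> V \<and> covers X \<B>" and
      X_min: "\<And>Y. Y \<subseteq> V \<and> covers Y \<B> \<Longrightarrow> card X \<le> card Y"
      using ex_has_least_nat[of "\<lambda>X. X \<subseteq> V \<and> covers X \<B>" X0 card] by auto
    then have X: "X \<subseteq> V" "covers X \<B>" "card X \<le> w" using X0 by (auto intro: order_trans)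
    have finX: "finite X" using X(1) V(1) by (rule finite_subset)
    have admX: "admissible w \<B> X" using X by (simp add: admissible_def)
    have component: "\<exists>\<R>. rooted_td E (X \<union> C) X \<R> \<and> (\<forall>Q\<in>\<R>. admissible w \<B> Q)"
      if C: "connected_in E C" "C \<subseteq> V - X" "neighbourhood E C \<subseteq> X" for C
    proof (cases "\<exists>B\<in>\<B>. \<not> connected_in E (B \<union> C)")
      case True
      then obtain B where B: "B \<in> \<B>" "\<not> connected_in E (B \<union> C)" by auto
      have conB: "connected_in E B" using less.prems B(1) by (auto simp: bramble_def)
      let ?Y = "C \<union> neighbourhood E C"
      have "B \<inter> ?Y = {}"
      proof (rule ccontr)
        assume "B \<inter> ?Y \<noteq> {}"
        then have "B \<inter> C \<noteq> {} \<or> (\<exists>p\<in>B. \<exists>q\<in>C. (p, q) \<in> E)"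
          using V(3) by (auto simp: neighbourhood_def dest: symD)
        then show False using connected_in_Un[OF V(3) conB C(1)] B(2) by blast
      qed
      then have "admissible w \<B> ?Y" using B(1) by (auto simp: admissible_def covers_def)
      moreover have "rooted_td E (X \<union> ?Y) X ({X} \<union> {?Y})"
        by (rule rooted_td.join[OF rooted_td.single rooted_td.single])
          (use V(3) C in \<open>auto simp: neighbourhood_def dest: symD\<close>)
      moreover have "X \<union> ?Y = X \<union> C" using C(3) by auto
      ultimately show ?thesis using admX by (intro exI[of _ "{X} \<union> {?Y}"]) auto
    next
      case False
      have "C \<notin> \<B>" using X(2) C(2) by (auto simp: covers_def)
      have br: "bramble V E (insert C \<B>)"
        using less.prems False C by (auto simp: bramble_def Un_commute)
      have "card (Pow V - insert C \<B>) < card (Pow V - \<B>)"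
        by (rule psubset_card_mono) (use \<open>C \<notin> \<B>\<close> C(2) V(1) in auto)
      from less.hyps[OF this br] obtain R \<R> where td: "rooted_td E V R \<R>"
        "\<forall>Q\<in>\<R>. admissible w (insert C \<B>) Q" by blast
      then obtain Z where Z: "Z \<in> \<R>" "\<not> admissible w \<B> Z" using none by blast
      then have ZB: "covers Z \<B>" "\<not> covers Z (insert C \<B>)"
        using td(2) by (auto simp: admissible_def)
      then have ZC: "Z \<inter> C = {}" by (auto simp: covers_def)
      have tdZ: "rooted_td E V Z \<R>" by (rule rooted_td_reroot[OF V(3) td(1) Z(1)])
      have ZV: "Z \<subseteq> V" by (rule rooted_td_bag_subset[OF tdZ Z(1)])
      \<comment> \<open>linking \<open>X\<close> to \<open>Z\<close> outside \<open>C\<close> keeps the contracted sets away from the part that is decomposed\<close>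
      let ?E = "E \<inter> (V - C) \<times> (V - C)"
      have E: "finite ?E" "sym ?E" "irrefl ?E" using finE V(3,4) by (auto simp: sym_def irrefl_def)
      have sep: "card X \<le> card S" if S: "finite S" "hits ?E X Z S" for S
      proof -
        have "covers (S \<inter> V) \<B>"
          unfolding covers_def
        proof
          fix B assume B: "B \<in> \<B>"
          have conB: "connected_in E B" "B \<subseteq> V" using less.prems B by (auto simp: bramble_def)
          have BX: "B \<inter> X \<noteq> {}" "B \<inter> Z \<noteq> {}" using X(2) ZB(1) B by (auto simp: covers_def)
          then obtain z where z: "z \<in> B" "z \<in> Z" by auto
          define Q where "Q = {v. (z, v) \<in> rtrancl_on (B - C) E}"
          have zBC: "z \<in> B - C" using z ZC by auto
          have conQ: "connected_in E Q" unfolding Q_def by (rule connected_in_reachable[OF V(3) zBC])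
          have Q_sub: "Q \<subseteq> B - C" "z \<in> Q" using zBC by (auto simp: Q_def dest: in_rtrancl_on_in_F)
          have QX: "Q \<inter> X \<noteq> {}"
          proof
            assume QX: "Q \<inter> X = {}"
            have "B \<subseteq> Q"
            proof (rule connected_in_subset[OF conB(1) z(1) Q_sub(2)])
              fix u v assume uv: "u \<in> B" "u \<in> Q" "v \<in> B" "(u, v) \<in> E"
              have "v \<notin> C"
              proof
                assume "v \<in> C"
                then have "u \<in> neighbourhood E C" using uv Q_sub V(3) by (auto simp: neighbourhood_def dest: symD)
                then show False using C(3) QX uv by auto
              qed
              then show "v \<in> Q" using uv unfolding Q_def by (auto intro: rtrancl_on_into_rtrancl_on)
            qed
            then show False using QX BX by auto
          qed
          have "connected_in ?E Q" by (rule connected_in_restrict[OF conQ]) (use Q_sub conB in auto)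
          then have "Q \<inter> S \<noteq> {}" using S(2) QX Q_sub(2) z(2) by (auto simp: hits_def)
          then show "B \<inter> (S \<inter> V) \<noteq> {}" using Q_sub conB(2) by auto
        qed
        then have "card X \<le> card (S \<inter> V)" using X_min by auto
        also have "\<dots> \<le> card S" using S(1) by (intro card_mono) auto
        finally show ?thesis .
      qed
      have finZ: "finite Z" using ZV V(1) by (rule finite_subset)
      obtain P where P: "disjoint_family_on P X"
        "\<And>x. x \<in> X \<Longrightarrow> x \<in> P x \<and> connected_in ?E (P x) \<and> P x \<inter> Z \<noteq> {}"
        using menger_from[OF E finX finZ sep] by blast
      have P': "x \<in> P x \<and> connected_in E (P x) \<and> P x \<inter> Z \<noteq> {} \<and> P x \<inter> C = {}" if "x \<in> X" for x
      proof -
        have "P x \<subseteq> V - C"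
          by (rule connected_in_domain[of E _ _ x]) (use P(2)[OF that] that X(1) C(2) in auto)
        then show ?thesis using P(2)[OF that] by (auto elim: connected_in_mono)
      qed
      have "\<exists>\<R>'. rooted_td E (V \<inter> (X \<union> C)) ((X \<inter> V) \<union> (Z \<inter> C)) \<R>' \<and> (\<forall>Q\<in>\<R>'. admissible w \<B> Q)"
        by (rule rooted_td_contract[OF V(2,3,1) X(1,3) P(1) P' _ tdZ _ _ _ td(2)])
          (use less.prems ZB(1) in \<open>auto simp: bramble_def covers_def\<close>)
      moreover have "V \<inter> (X \<union> C) = X \<union> C" "(X \<inter> V) \<union> (Z \<inter> C) = X" using X(1) C(2) ZC by auto
      ultimately show ?thesis by simp
    qed
    \<comment> \<open>glue the components one at a time onto a part \<open>U\<close> that is a union of components and \<open>X\<close>\<close>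
    have "\<exists>\<R>. rooted_td E V X \<R> \<and> (\<forall>Q\<in>\<R>. admissible w \<B> Q)"
      if "X \<subseteq> U" "U \<subseteq> V" "\<And>u v. u \<in> U - X \<Longrightarrow> v \<in> V - U \<Longrightarrow> (u, v) \<notin> E"
        "\<exists>\<R>. rooted_td E U X \<R> \<and> (\<forall>Q\<in>\<R>. admissible w \<B> Q)" for U
      using that
    proof (induct "card (V - U)" arbitrary: U rule: less_induct)
      case (less U)
      note U = less.prems
      show ?case
      proof (cases "U = V")
        case True
        then show ?thesis using U(4) by simp
      next
        case False
        then obtain v where v: "v \<in> V" "v \<notin> U" using U(2) by auto
        define C where "C = {u. (v, u) \<in> rtrancl_on (V - X) E}"
        have vX: "v \<in> V - X" using v U(1) by auto
        have C: "connected_in E C" "C \<subseteq> V - X" "v \<in> C"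
          unfolding C_def using connected_in_reachable[OF V(3) vX] vX by (auto dest: in_rtrancl_on_in_F)
        have C_step: "b \<in> C" if "a \<in> C" "(a, b) \<in> E" "b \<notin> X" for a b
          using that V(2) unfolding C_def by (auto intro: rtrancl_on_into_rtrancl_on)
        then have "neighbourhood E C \<subseteq> X" by (auto simp: neighbourhood_def)
        from component[OF C(1,2) this] obtain \<R>1 where
          td1: "rooted_td E (X \<union> C) X \<R>1" "\<forall>Q\<in>\<R>1. admissible w \<B> Q" by blast
        obtain \<R>2 where td2: "rooted_td E U X \<R>2" "\<forall>Q\<in>\<R>2. admissible w \<B> Q" using U(4) by blast
        have CU: "C \<subseteq> V - U"
        proof (rule connected_in_subset[OF C(1,3)])
          show "v \<in> V - U" using v by auto
          fix a b assume ab: "a \<in> C" "a \<in> V - U" "b \<in> C" "(a, b) \<in> E"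
          then have "(b, a) \<in> E" "b \<in> V - X" using V(3) C(2) by (auto dest: symD)
          then show "b \<in> V - U" using U(3)[of b a] ab by auto
        qed
        have "rooted_td E (U \<union> (X \<union> C)) X (\<R>2 \<union> \<R>1)"
          by (rule rooted_td.join[OF td2(1) td1(1)]) (use CU U(1,3) in auto)
        moreover have "U \<union> (X \<union> C) = U \<union> C" using U(1) by auto
        ultimately have "\<exists>\<R>. rooted_td E (U \<union> C) X \<R> \<and> (\<forall>Q\<in>\<R>. admissible w \<B> Q)"
          using td1(2) td2(2) by (intro exI[of _ "\<R>2 \<union> \<R>1"]) auto
        moreover have "card (V - (U \<union> C)) < card (V - U)"
          by (rule psubset_card_mono) (use V(1) v C(3) in auto)
        moreover have "(a, b) \<notin> E" if "a \<in> U \<union> C - X" "b \<in> V - (U \<union> C)" for a b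
          using that U(1,3) C_step by blast
        ultimately show ?thesis using less.hyps[of "U \<union> C"] U(1,2) CU by blast
      qed
    qed
    from this[of X] have "\<exists>\<R>. rooted_td E V X \<R> \<and> (\<forall>Q\<in>\<R>. admissible w \<B> Q)"
      using X(1) admX rooted_td.single[of E X] by auto
    with none show False by blast
  qed
qed

corollary rooted_td_of_small_brambles:
  fixes V :: "'a set"
  assumes "finite V" "E \<subseteq> V \<times> V" "sym E" "irrefl E"
    and "\<And>\<B>. bramble V E \<B> \<Longrightarrow> \<exists>X\<subseteq>V. card X \<le> w \<and> covers X \<B>"
  obtains R \<R> where "rooted_td E V R \<R>" "\<And>Q. Q \<in> \<R> \<Longrightarrow> card Q \<le> w"
proof -
  have "\<exists>R \<R>. rooted_td E V R \<R> \<and> (\<forall>Q\<in>\<R>. admissible w {} Q)"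
    by (rule bramble_admissible_td[OF assms]) (auto simp: bramble_def)
  then show ?thesis using that by (auto simp: admissible_def covers_def)
qed

section \<open>Growing a model of a forest at the boundary of a large set\<close>

text \<open>
  Every nonempty set of vertices has a member with at most one neighbour in it. For finite
  graphs this characterises forests (\<open>undirected_forest_iff\<close>), and it is the form in which
  leaves are removed.
\<close>

definition one_degenerate :: "'a rel \<Rightarrow> 'a set \<Rightarrow> bool" where
  "one_degenerate F W \<longleftrightarrow> (\<forall>S\<subseteq>W. S \<noteq> {} \<longrightarrow>
     (\<exists>v\<in>S. \<forall>a\<in>S. \<forall>b\<in>S. (v, a) \<in> F \<longrightarrow> (v, b) \<in> F \<longrightarrow> a = b))"

lemma one_degenerateD:
  assumes "one_degenerate F W" "S \<subseteq> W" "S \<noteq> {}"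
  shows "\<exists>v\<in>S. \<forall>a\<in>S. \<forall>b\<in>S. (v, a) \<in> F \<longrightarrow> (v, b) \<in> F \<longrightarrow> a = b"
  using assms by (simp add: one_degenerate_def)

lemma one_degenerate_restrict:
  assumes "one_degenerate F W" "W' \<subseteq> W'' \<inter> W" "F' \<inter> W'' \<times> W'' \<subseteq> F"
  shows "one_degenerate F' W'"
  unfolding one_degenerate_def
proof (intro allI impI)
  fix S assume S: "S \<subseteq> W'" "S \<noteq> {}"
  have SW: "S \<subseteq> W" using S(1) assms(2) by auto
  from one_degenerateD[OF assms(1) SW S(2)] obtain v where v: "v \<in> S"
    "\<forall>a\<in>S. \<forall>b\<in>S. (v, a) \<in> F \<longrightarrow> (v, b) \<in> F \<longrightarrow> a = b" by (rule bexE)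
  moreover have "(v, a) \<in> F" if "a \<in> S" "(v, a) \<in> F'" for a
  proof -
    have "(v, a) \<in> F' \<inter> W'' \<times> W''" using that v(1) S(1) assms(2) by auto
    then show ?thesis using assms(3) by (rule rev_subsetD)
  qed
  ultimately show "\<exists>v\<in>S. \<forall>a\<in>S. \<forall>b\<in>S. (v, a) \<in> F' \<longrightarrow> (v, b) \<in> F' \<longrightarrow> a = b" by auto
qed

definition large :: "'a rel \<Rightarrow> 'a set set \<Rightarrow> 'a set \<Rightarrow> bool" where
  "large E \<B> C \<longleftrightarrow> connected_in E C \<and> (\<exists>B\<in>\<B>. B \<subseteq> C)"

definition branch_sets :: "'a rel \<Rightarrow> 'b rel \<Rightarrow> 'b set \<Rightarrow> ('b \<Rightarrow> 'a set) \<Rightarrow> bool" where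
  "branch_sets E F W M \<longleftrightarrow> (\<forall>f\<in>W. connected_in E (M f)) \<and> disjoint_family_on M W \<and>
     (\<forall>f\<in>W. \<forall>g\<in>W. (f, g) \<in> F \<longrightarrow> (\<exists>x\<in>M f. \<exists>y\<in>M g. (x, y) \<in> E))"

text \<open>
  The state of the construction: \<open>M\<close> models \<open>F\<close> on \<open>W\<close> outside the large set \<open>C\<close>, and as \<open>C\<close> has
  as many neighbours as there are disjoint branch sets meeting its neighbourhood, each branch
  set contains exactly one of them. The last condition makes sure that this can be continued
  inside \<open>C\<close>.
\<close>

definition attached_model ::
    "'a set \<Rightarrow> 'a rel \<Rightarrow> 'a set set \<Rightarrow> 'b rel \<Rightarrow> 'b set \<Rightarrow> 'a set \<Rightarrow> ('b \<Rightarrow> 'a set) \<Rightarrow> bool" where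
  "attached_model V E \<B> F W C M \<longleftrightarrow> C \<subseteq> V \<and> large E \<B> C \<and> card (neighbourhood E C) = card W \<and>
     branch_sets E F W M \<and> (\<forall>f\<in>W. M f \<subseteq> V - C \<and> M f \<inter> neighbourhood E C \<noteq> {}) \<and>
     (\<forall>C'\<subseteq>C. large E \<B> C' \<longrightarrow> card W \<le> card (neighbourhood E C'))"

lemma neighbourhood_reachable:
  "neighbourhood E {u. (b, u) \<in> rtrancl_on D E} \<subseteq> - D"
  by (auto simp: neighbourhood_def intro: rtrancl_on_into_rtrancl_on)

lemma connected_in_subset_reachable:
  assumes "connected_in E B" "B \<subseteq> D" "b \<in> B"
  shows "B \<subseteq> {u. (b, u) \<in> rtrancl_on D E}"
  by (rule connected_in_subset[OF assms(1,3)]) (use assms in \<open>auto intro: rtrancl_on_into_rtrancl_on\<close>)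

text \<open>
  The neighbours of \<open>C\<close> together with \<open>y\<close> miss an element of the bramble. It touches the element
  inside \<open>C\<close> and cannot cross the neighbourhood of \<open>C\<close>, so it lies in \<open>C - y\<close>; take the
  component around it.
\<close>

lemma large_shrink:
  assumes V: "finite V" "E \<subseteq> V \<times> V" "sym E"
    and \<B>: "bramble V E \<B>" "\<And>X. X \<subseteq> V \<Longrightarrow> card X \<le> w \<Longrightarrow> \<not> covers X \<B>"
    and C: "large E \<B> C" "C \<subseteq> V" "y \<in> C" "card (neighbourhood E C) < w"
  obtains C1 where "large E \<B> C1" "C1 \<subseteq> C - {y}" "neighbourhood E C1 \<subseteq> insert y (neighbourhood E C)"
proof -
  obtain B where B: "B \<in> \<B>" "B \<subseteq> C" using C(1) by (auto simp: large_def)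
  have neighbourhoodV: "neighbourhood E C \<subseteq> V" using V(2) by (auto simp: neighbourhood_def)
  have fin: "finite (neighbourhood E C)" using neighbourhoodV V(1) by (rule finite_subset)
  have "\<not> covers (insert y (neighbourhood E C)) \<B>"
    by (rule \<B>(2)) (use neighbourhoodV C(2-4) fin card_insert_le_m1[of w "neighbourhood E C" y] in auto)
  then obtain B1 where B1: "B1 \<in> \<B>" "B1 \<inter> insert y (neighbourhood E C) = {}" by (auto simp: covers_def)
  have con: "connected_in E (B \<union> B1)" "connected_in E B" "connected_in E B1"
    using \<B>(1) B(1) B1(1) by (auto simp: bramble_def)
  obtain b0 where b0: "b0 \<in> B" using connected_in_nonempty[OF con(2)] by auto
  have "B \<union> B1 \<subseteq> C"
    by (rule connected_in_subset[OF con(1), of b0]) (use b0 B B1 in \<open>auto simp: neighbourhood_def\<close>)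
  then have B1C: "B1 \<subseteq> C - {y}" using B1 by auto
  obtain b where b: "b \<in> B1" using connected_in_nonempty[OF con(3)] by auto
  define C1 where "C1 = {u. (b, u) \<in> rtrancl_on (C - {y}) E}"
  have "b \<in> C - {y}" using b B1C by auto
  then have "connected_in E C1" unfolding C1_def by (rule connected_in_reachable[OF V(3)])
  moreover have "B1 \<subseteq> C1"
    unfolding C1_def by (rule connected_in_subset_reachable[OF con(3) B1C b])
  ultimately have 1: "large E \<B> C1" using B1(1) by (auto simp: large_def)
  have 2: "C1 \<subseteq> C - {y}" by (auto simp: C1_def dest: in_rtrancl_on_in_F)
  have "neighbourhood E C1 \<subseteq> insert y (neighbourhood E C)"
    using neighbourhood_reachable[of E b "C - {y}"] 2 unfolding C1_def[symmetric] by (auto simp: neighbourhood_def)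
  with 1 2 show ?thesis by (rule that)
qed

text \<open>
  By minimality no fewer than \<open>card W\<close> vertices separate the neighbourhood of \<open>C\<close> from that of
  \<open>C'\<close> within \<open>C\<close> and its neighbours, since the component around \<open>C'\<close> that they cut off would be
  a large set with too few neighbours. Each branch set is prolonged by the linking sets that
  start in it.
\<close>

lemma attached_model_advance:
  fixes V :: "'a set"
  assumes V: "finite V" "E \<subseteq> V \<times> V" "sym E" "irrefl E"
    and am: "attached_model V E \<B> F W C M"
    and C': "large E \<B> C'" "C' \<subseteq> C" "card (neighbourhood E C') \<le> card W"
  shows "\<exists>M'. attached_model V E \<B> F W C' M'"
proof -
  note am' = am[unfolded attached_model_def branch_sets_def]
  have C: "C \<subseteq> V" "large E \<B> C" "card (neighbourhood E C) = card W"
    and minimal: "\<And>D. D \<subseteq> C \<Longrightarrow> large E \<B> D \<Longrightarrow> card W \<le> card (neighbourhood E D)"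
    and M: "\<And>f. f \<in> W \<Longrightarrow> connected_in E (M f)" "\<And>f. f \<in> W \<Longrightarrow> M f \<subseteq> V - C"
      "\<And>f. f \<in> W \<Longrightarrow> M f \<inter> neighbourhood E C \<noteq> {}" "disjoint_family_on M W"
      "\<And>f g. f \<in> W \<Longrightarrow> g \<in> W \<Longrightarrow> (f, g) \<in> F \<Longrightarrow> \<exists>x\<in>M f. \<exists>y\<in>M g. (x, y) \<in> E"
    using am' by auto
  have finE: "finite E" using V(1,2) finite_subset by auto
  let ?S = "neighbourhood E C" and ?S' = "neighbourhood E C'"
  have SV: "?S \<subseteq> V" "?S' \<subseteq> V" using V(2) by (auto simp: neighbourhood_def)
  have fin: "finite ?S" "finite ?S'" using SV V(1) by (auto intro: finite_subset)
  let ?D = "(C \<union> ?S) - C'"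
  let ?E = "E \<inter> ?D \<times> ?D"
  have S'D: "?S' \<subseteq> ?D" using C'(2) by (auto simp: neighbourhood_def)
  have SD: "?S \<subseteq> ?D" using C'(2) by (auto simp: neighbourhood_def)
  have E: "finite ?E" "sym ?E" "irrefl ?E" using finE V(3,4) by (auto simp: sym_def irrefl_def)
  have sep: "card ?S \<le> card X" if X: "finite X" "hits ?E ?S ?S' X" for X
  proof -
    define Y where "Y = X \<inter> ?D"
    obtain B where B: "B \<in> \<B>" "B \<subseteq> C'" and conC': "connected_in E C'"
      using C'(1) by (auto simp: large_def)
    obtain c where c: "c \<in> C'" using connected_in_nonempty[OF conC'] by auto
    \<comment> \<open>the component around \<open>C'\<close> that is cut off by the separator\<close>
    define D where "D = {u. (c, u) \<in> rtrancl_on (C - Y) E}"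
    have C'Y: "C' \<subseteq> C - Y" using C'(2) by (auto simp: Y_def)
    have "c \<in> C - Y" using c C'Y by auto
    then have conD: "connected_in E D" unfolding D_def by (rule connected_in_reachable[OF V(3)])
    have C'D: "C' \<subseteq> D" unfolding D_def by (rule connected_in_subset_reachable[OF conC' C'Y c])
    have largeD: "large E \<B> D" using conD C'D B by (auto simp: large_def)
    have DC: "D \<subseteq> C - Y" by (auto simp: D_def dest: in_rtrancl_on_in_F)
    have "neighbourhood E D \<subseteq> Y"
    proof
      fix z assume z: "z \<in> neighbourhood E D"
      have zCY: "z \<notin> C - Y" using z neighbourhood_reachable[of E c "C - Y"] by (auto simp: D_def)
      show "z \<in> Y"
      proof (rule ccontr)
        assume zY: "z \<notin> Y"
        with zCY have "z \<notin> C" by auto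
        then have zS: "z \<in> ?S" using z DC by (auto simp: neighbourhood_def)
        have zD: "z \<in> ?D - Y" using zS SD zY by auto
        obtain d where d: "d \<in> D" "(d, z) \<in> E" using z by (auto simp: neighbourhood_def)
        define Q where "Q = {u. (z, u) \<in> rtrancl_on (?D - Y) E}"
        have conQ: "connected_in E Q" unfolding Q_def by (rule connected_in_reachable[OF V(3) zD])
        have Q: "Q \<subseteq> ?D - Y" "z \<in> Q" using zD by (auto simp: Q_def dest: in_rtrancl_on_in_F)
        have "connected_in ?E Q" by (rule connected_in_restrict[OF conQ]) (use Q in auto)
        moreover have "Q \<inter> X = {}" using Q(1) by (auto simp: Y_def)
        ultimately have QS': "Q \<inter> ?S' = {}" using X(2) Q(2) zS unfolding hits_def by blast
        have Q_step: "v \<in> Q" if "u \<in> Q" "(u, v) \<in> E" "v \<in> D \<union> {z}" for u v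
        proof -
          have "v \<notin> C'"
          proof
            assume "v \<in> C'"
            then have "u \<in> ?S'" using that Q(1) V(3) by (auto simp: neighbourhood_def dest: symD)
            then show False using QS' that(1) by auto
          qed
          then have "v \<in> ?D - Y" using that(3) DC zD by auto
          then show ?thesis using that(1,2) unfolding Q_def by (auto intro: rtrancl_on_into_rtrancl_on)
        qed
        have "(z, d) \<in> E" using d(2) V(3) by (simp add: symD)
        then have "d \<in> Q" using Q_step[OF Q(2), of d] d(1) by auto
        have "D \<subseteq> Q"
          by (rule connected_in_subset[OF conD d(1) \<open>d \<in> Q\<close>]) (use Q_step in auto)
        then show False using c C'D Q(1) by auto
      qed
    qed
    then have "card (neighbourhood E D) \<le> card Y" using X(1) by (intro card_mono) (auto simp: Y_def)
    also have "\<dots> \<le> card X" unfolding Y_def using X(1) by (intro card_mono) auto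
    finally show ?thesis using minimal[OF _ largeD] DC C(3) by (auto simp: subset_iff)
  qed
  obtain P where P: "disjoint_family_on P ?S"
    "\<And>s. s \<in> ?S \<Longrightarrow> s \<in> P s \<and> connected_in ?E (P s) \<and> P s \<inter> ?S' \<noteq> {}"
    using menger_from[OF E fin sep] by blast
  have P_sub: "P s \<subseteq> ?D" if "s \<in> ?S" for s
    by (rule connected_in_domain[of E _ _ s]) (use P(2)[OF that] SD that in auto)
  have P_con: "connected_in E (P s)" if "s \<in> ?S" for s
    by (rule connected_in_mono[of ?E]) (use P(2)[OF that] in auto)
  have P_S: "s = t" if "s \<in> ?S" "t \<in> ?S" "t \<in> P s" for s t
    using P(1) P(2)[OF that(2)] that unfolding disjoint_family_on_def by blast
  define M' where "M' f = M f \<union> (\<Union>s\<in>M f \<inter> ?S. P s)" for f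
  have M'_disj: "disjoint_family_on M' W"
    unfolding disjoint_family_on_def
  proof (intro ballI impI, rule ccontr)
    fix f g assume fg: "f \<in> W" "g \<in> W" "f \<noteq> g" "M' f \<inter> M' g \<noteq> {}"
    then have disj: "M f \<inter> M g = {}" using M(4) by (auto simp: disjoint_family_on_def)
    \<comment> \<open>a linking set meets the old branch sets only in the neighbourhood of \<open>C\<close>, and there only in its own start\<close>
    have cross: False if "s \<in> M a" "s \<in> ?S" "z \<in> P s" "z \<in> M b" "M a \<inter> M b = {}" "b \<in> W" for a b s z
    proof -
      have "z \<in> ?S" using P_sub[OF that(2)] that(3,4) M(2)[OF that(6)] by auto
      then have "s = z" using that(2,3) by (intro P_S)
      then show False using that by auto
    qed
    obtain z where z: "z \<in> M' f" "z \<in> M' g" using fg by auto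
    have gf: "M g \<inter> M f = {}" using disj by auto
    consider "z \<in> M f" | s where "s \<in> M f" "s \<in> ?S" "z \<in> P s"
      using z(1) by (auto simp: M'_def)
    then show False
    proof cases
      case 1
      from z(2) consider "z \<in> M g" | t where "t \<in> M g" "t \<in> ?S" "z \<in> P t"
        by (auto simp: M'_def)
      then show False
      proof cases
        case 2
        then show False using cross[OF _ _ _ 1 gf fg(1)] by auto
      qed (use 1 disj in auto)
    next
      case (2 s)
      from z(2) consider "z \<in> M g" | t where "t \<in> M g" "t \<in> ?S" "z \<in> P t"
        by (auto simp: M'_def)
      then show False
      proof cases
        case 1
        show False by (rule cross[OF 2 1 disj fg(2)])
      next
        case (2 t)
        then have "s = t" using \<open>s \<in> ?S\<close> \<open>z \<in> P s\<close> P(1) by (auto simp: disjoint_family_on_def)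
        then show False using \<open>s \<in> M f\<close> \<open>t \<in> M g\<close> disj by auto
      qed
    qed
  qed
  have "attached_model V E \<B> F W C' M'"
    unfolding attached_model_def branch_sets_def
  proof (intro conjI ballI impI allI)
    show "C' \<subseteq> V" using C'(2) C(1) by auto
    show "large E \<B> C'" by (rule C'(1))
    show "card ?S' = card W" using C'(3) minimal[OF C'(2,1)] by simp
    show "disjoint_family_on M' W" by (rule M'_disj)
  next
    fix f assume f: "f \<in> W"
    show "connected_in E (M' f)"
      unfolding M'_def by (rule connected_in_UN[OF V(3) M(1)[OF f]]) (use P(2) P_con in auto)
    show "M' f \<subseteq> V - C'" using M(2)[OF f] C'(2) P_sub C(1) SV unfolding M'_def by blast
    show "M' f \<inter> ?S' \<noteq> {}" using M(3)[OF f] P(2) unfolding M'_def by blast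
  next
    fix f g assume "f \<in> W" "g \<in> W" "(f, g) \<in> F"
    then show "\<exists>x\<in>M' f. \<exists>y\<in>M' g. (x, y) \<in> E" using M(5)[of f g] by (auto simp: M'_def)
  next
    fix D assume "D \<subseteq> C'" "large E \<B> D"
    then show "card W \<le> card (neighbourhood E D)" using minimal[of D] C'(2) by auto
  qed
  then show ?thesis by blast
qed

text \<open>
  Induction on \<open>W\<close>: a vertex with at most one neighbour in \<open>W\<close> is modelled last.
\<close>

theorem attached_model_exists:
  fixes V :: "'a set" and W :: "'b set"
  assumes V: "finite V" "E \<subseteq> V \<times> V" "sym E" "irrefl E"
    and \<B>: "bramble V E \<B>" "\<And>X. X \<subseteq> V \<Longrightarrow> card X \<le> w \<Longrightarrow> \<not> covers X \<B>"
    and F: "sym F" "irrefl F"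
    and W: "finite W" "one_degenerate F W" "card W \<le> w"
  shows "\<exists>C M. attached_model V E \<B> F W C M"
  using W
proof (induct "card W" arbitrary: W)
  case 0
  then have "W = {}" by simp
  have "\<not> covers {} \<B>" by (rule \<B>(2)) auto
  then obtain B where B: "B \<in> \<B>" by (auto simp: covers_def)
  then have conB: "connected_in E B" "B \<subseteq> V" using \<B>(1) by (auto simp: bramble_def)
  then obtain b where b: "b \<in> B" using connected_in_nonempty by blast
  define C where "C = {u. (b, u) \<in> rtrancl_on V E}"
  have "b \<in> V" using b conB by auto
  then have "connected_in E C" unfolding C_def by (rule connected_in_reachable[OF V(3)])
  moreover have "B \<subseteq> C" unfolding C_def by (rule connected_in_subset_reachable[OF conB b])
  moreover have "neighbourhood E C = {}"
    using neighbourhood_reachable[of E b V] V(2) by (auto simp: C_def neighbourhood_def)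
  moreover have "C \<subseteq> V" by (auto simp: C_def dest: in_rtrancl_on_in_F)
  ultimately have "attached_model V E \<B> F W C (\<lambda>_. {})"
    using B \<open>W = {}\<close> by (auto simp: attached_model_def branch_sets_def large_def disjoint_family_on_def)
  then show ?case by blast
next
  case (Suc k)
  have "W \<noteq> {}" using Suc(2) by auto
  from one_degenerateD[OF Suc(4) order_refl this] obtain v where v: "v \<in> W"
    and "\<forall>a\<in>W. \<forall>b\<in>W. (v, a) \<in> F \<longrightarrow> (v, b) \<in> F \<longrightarrow> a = b" by (rule bexE)
  then have leaf: "\<And>a b. a \<in> W \<Longrightarrow> b \<in> W \<Longrightarrow> (v, a) \<in> F \<Longrightarrow> (v, b) \<in> F \<Longrightarrow> a = b" by simp
  let ?W = "W - {v}"
  have k: "k = card ?W" "k < w" using Suc(2,3,5) v by auto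
  have "\<exists>C M. attached_model V E \<B> F ?W C M"
    by (rule Suc(1)[OF k(1)]) (use Suc(3) one_degenerate_restrict[OF Suc(4), of ?W UNIV F] k in auto)
  then obtain C0 where "\<exists>M. attached_model V E \<B> F ?W C0 M" by blast
  \<comment> \<open>a smallest \<open>C\<close> excludes every large proper subset to which the model could advance\<close>
  then obtain C where "\<exists>M. attached_model V E \<B> F ?W C M" and
    least: "\<And>D. \<exists>M. attached_model V E \<B> F ?W D M \<Longrightarrow> card C \<le> card D"
    using ex_has_least_nat[of "\<lambda>C. \<exists>M. attached_model V E \<B> F ?W C M" C0 card] by auto
  then obtain M where am: "attached_model V E \<B> F ?W C M" by blast
  note am' = am[unfolded attached_model_def branch_sets_def]
  have C: "C \<subseteq> V" "large E \<B> C" "card (neighbourhood E C) = card ?W"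
    and M: "\<And>f. f \<in> ?W \<Longrightarrow> connected_in E (M f)" "\<And>f. f \<in> ?W \<Longrightarrow> M f \<subseteq> V - C"
      "\<And>f. f \<in> ?W \<Longrightarrow> M f \<inter> neighbourhood E C \<noteq> {}" "disjoint_family_on M ?W"
      "\<And>f g. f \<in> ?W \<Longrightarrow> g \<in> ?W \<Longrightarrow> (f, g) \<in> F \<Longrightarrow> \<exists>x\<in>M f. \<exists>y\<in>M g. (x, y) \<in> E"
    using am' by auto
  have "C \<noteq> {}" using C(2) connected_in_nonempty by (auto simp: large_def)
  have "\<exists>y\<in>C. \<forall>u\<in>?W. (v, u) \<in> F \<longrightarrow> (\<exists>s\<in>M u. (s, y) \<in> E)"
  proof (cases "\<exists>u\<in>?W. (v, u) \<in> F")
    case True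
    then obtain u where u: "u \<in> ?W" "(v, u) \<in> F" by blast
    obtain s where s: "s \<in> M u" "s \<in> neighbourhood E C" using M(3)[OF u(1)] by auto
    then obtain y where "y \<in> C" "(y, s) \<in> E" by (auto simp: neighbourhood_def)
    then show ?thesis using leaf[of _ u] u s V(3) by (auto dest: symD)
  next
    case False
    then show ?thesis using \<open>C \<noteq> {}\<close> by blast
  qed
  then obtain y where y: "y \<in> C" "\<And>u. u \<in> ?W \<Longrightarrow> (v, u) \<in> F \<Longrightarrow> \<exists>s\<in>M u. (s, y) \<in> E" by blast
  have "card (neighbourhood E C) < w" using C(3) k by simp
  from large_shrink[OF V(1-3) \<B> C(2,1) y(1) this]
  obtain C1 where C1: "large E \<B> C1" "C1 \<subseteq> C - {y}" "neighbourhood E C1 \<subseteq> insert y (neighbourhood E C)" .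
  \<comment> \<open>the condition on large subsets that the enlarged model needs\<close>
  have grow: "card W \<le> card (neighbourhood E D)" if D: "D \<subseteq> C - {y}" "large E \<B> D" for D
  proof (rule ccontr)
    assume "\<not> card W \<le> card (neighbourhood E D)"
    then have "card (neighbourhood E D) \<le> card ?W" using Suc(2) k by simp
    then have "card C \<le> card D"
      using D(1) by (intro least attached_model_advance[OF V am D(2)]) auto
    moreover have "card D < card C"
      by (rule psubset_card_mono) (use D(1) y(1) C(1) V(1) in \<open>auto intro: finite_subset\<close>)
    ultimately show False by simp
  qed
  have finS: "finite (neighbourhood E C)"
    by (rule finite_subset[OF _ V(1)]) (use V(2) in \<open>auto simp: neighbourhood_def\<close>)
  have yS: "y \<notin> neighbourhood E C" using y(1) by (auto simp: neighbourhood_def)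
  have neighbourhood1: "neighbourhood E C1 = insert y (neighbourhood E C)"
  proof (rule card_seteq[OF _ C1(3)])
    show "card (insert y (neighbourhood E C)) \<le> card (neighbourhood E C1)"
      using grow[OF C1(2,1)] C(3) k Suc(2) yS finS by simp
  qed (use finS in simp)
  define N where "N = M(v := {y})"
  have N: "N v = {y}" "\<And>f. f \<in> ?W \<Longrightarrow> N f = M f" by (auto simp: N_def)
  have Wcases: "f = v \<or> f \<in> ?W" if "f \<in> W" for f using that by auto
  have "attached_model V E \<B> F W C1 N"
    unfolding attached_model_def branch_sets_def
  proof (intro conjI ballI impI allI)
    show "C1 \<subseteq> V" using C1(2) C(1) by auto
    show "large E \<B> C1" by (rule C1(1))
    show "card (neighbourhood E C1) = card W" using neighbourhood1 yS finS C(3) k Suc(2) by simp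
    have "y \<notin> M f" if "f \<in> ?W" for f using M(2)[OF that] y(1) by auto
    then show "disjoint_family_on N W"
      using M(4) unfolding disjoint_family_on_def N_def by auto
  next
    fix f assume f: "f \<in> W"
    show "connected_in E (N f)" using Wcases[OF f] N M(1) connected_in_singleton by auto
    have "N f \<subseteq> V - (C - {y})"
    proof (cases "f = v")
      case True
      then show ?thesis using N(1) y(1) C(1) by auto
    next
      case False
      then show ?thesis using N(2)[of f] M(2)[of f] f by auto
    qed
    then show "N f \<subseteq> V - C1" using C1(2) by auto
    show "N f \<inter> neighbourhood E C1 \<noteq> {}" using Wcases[OF f] N M(3)[of f] neighbourhood1 by auto
  next
    fix f g assume fg: "f \<in> W" "g \<in> W" "(f, g) \<in> F"
    then have "f \<noteq> g" using F(2) by (auto simp: irrefl_def)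
    have gf: "(g, f) \<in> F" using F(1) fg(3) by (rule symD)
    show "\<exists>x\<in>N f. \<exists>z\<in>N g. (x, z) \<in> E"
    proof (cases "f = v")
      case True
      then have "g \<in> ?W" using fg \<open>f \<noteq> g\<close> by auto
      then show ?thesis using y(2)[of g] fg(3) True N V(3) by (auto dest: symD)
    next
      case False
      then have f: "f \<in> ?W" using fg by auto
      show ?thesis
      proof (cases "g = v")
        case True
        then show ?thesis using y(2)[OF f] gf N(1) N(2)[OF f] by auto
      next
        case False
        then show ?thesis using M(5)[OF f _ fg(3)] fg(2) N(2)[OF f] N(2)[of g] by auto
      qed
    qed
  next
    fix D assume "D \<subseteq> C1" "large E \<B> D"
    then show "card W \<le> card (neighbourhood E D)" using grow[of D] C1(2) by auto
  qed
  then show ?case by blast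
qed

section \<open>Forests and tree-decompositions\<close>

text \<open>
  Connectedness in the sense of the digraph library symmetrises the arcs first, which changes
  nothing for a symmetric relation.
\<close>

lemma connected_in_iff_connected_induced:
  assumes "sym (parcs T)"
  shows "connected (with_proj T \<restriction> S) \<longleftrightarrow> connected_in (parcs T) S"
proof -
  have ends: "arcs_ends (with_proj T \<restriction> S) = parcs T \<inter> S \<times> S"
    by (auto simp: arcs_ends_conv)
  have "(parcs T \<inter> S \<times> S)\<^sup>s = parcs T \<inter> S \<times> S"
    using assms by (auto simp: symcl_def dest: symD)
  moreover have "(u, v) \<in> rtrancl_on S (parcs T \<inter> S \<times> S) \<longleftrightarrow> (u, v) \<in> rtrancl_on S (parcs T)" for u v
  proof
    assume "(u, v) \<in> rtrancl_on S (parcs T)"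
    then show "(u, v) \<in> rtrancl_on S (parcs T \<inter> S \<times> S)"
      by (induct rule: rtrancl_on_induct) (auto intro: rtrancl_on_into_rtrancl_on)
  next
    assume "(u, v) \<in> rtrancl_on S (parcs T \<inter> S \<times> S)"
    then show "(u, v) \<in> rtrancl_on S (parcs T)"
      by (induct rule: rtrancl_on_induct) (auto intro: rtrancl_on_into_rtrancl_on)
  qed
  ultimately show ?thesis
    by (simp add: connected_conv ends connected_in_def)
qed

lemma connected_in_iff_connected:
  assumes "sym (parcs T)"
  shows "connected (with_proj T) \<longleftrightarrow> connected_in (parcs T) (pverts T)"
proof -
  have "(parcs T)\<^sup>s = parcs T" using assms by (auto simp: symcl_def dest: symD)
  then show ?thesis by (simp add: connected_conv connected_in_def)
qed

lemma pcas_nth: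
  assumes "pcas u p v" "i < length p"
  shows "fst (p ! i) = (if i = 0 then u else snd (p ! (i - 1)))"
  using assms
proof (induct p arbitrary: u i)
  case (Cons e p)
  then show ?case by (cases i) (auto simp: nth_Cons split: nat.splits)
qed simp

lemma pcas_last: "pcas u p v \<Longrightarrow> p \<noteq> [] \<Longrightarrow> snd (last p) = v"
  by (induct p arbitrary: u) (auto split: if_splits)

lemma pawalk_verts_pcas: "pcas u p v \<Longrightarrow> pawalk_verts u p = u # map snd p"
  by (induct p arbitrary: u) auto

lemma pcas_zip_tl: "ys \<noteq> [] \<Longrightarrow> pcas (hd ys) (zip ys (tl ys @ [z])) z"
proof (induct ys)
  case (Cons y ys)
  then show ?case by (cases ys) auto
qed simp

text \<open>
  On a cycle of length at least 3 each vertex has two neighbours, its predecessor and its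
  successor.
\<close>

lemma cycle_not_one_degenerate:
  assumes E: "sym (parcs G)" and V: "parcs G \<subseteq> pverts G \<times> pverts G"
    and p: "pre_digraph.cycle (with_proj G) p" "3 \<le> length p"
  shows "\<not> one_degenerate (parcs G) (pverts G)"
proof
  assume deg: "one_degenerate (parcs G) (pverts G)"
  obtain u where p': "set p \<subseteq> parcs G" "pcas u p u" "distinct (map snd p)" "p \<noteq> []"
    using p(1) by (auto simp: pre_digraph.cycle_def pre_digraph.awalk_def cas_with_proj_eq
        awalk_verts_with_proj_eq pawalk_verts_pcas)
  let ?n = "length p"
  let ?S = "set (map snd p)"
  have "?S \<subseteq> pverts G" using p'(1) V by auto
  moreover have "?S \<noteq> {}" using p'(4) by simp
  ultimately have "\<exists>v\<in>?S. \<forall>a\<in>?S. \<forall>b\<in>?S. (v, a) \<in> parcs G \<longrightarrow> (v, b) \<in> parcs G \<longrightarrow> a = b"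
    by (rule one_degenerateD[OF deg])
  then obtain v where v: "v \<in> ?S"
    and "\<forall>a\<in>?S. \<forall>b\<in>?S. (v, a) \<in> parcs G \<longrightarrow> (v, b) \<in> parcs G \<longrightarrow> a = b" by (rule bexE)
  then have v2: "\<And>a b. a \<in> ?S \<Longrightarrow> b \<in> ?S \<Longrightarrow> (v, a) \<in> parcs G \<Longrightarrow> (v, b) \<in> parcs G \<Longrightarrow> a = b" by blast
  obtain i where i: "i < ?n" "v = snd (p ! i)" using v by (auto simp: in_set_conv_nth)
  \<comment> \<open>predecessor and successor of the \<open>i\<close>-th vertex, with indices read cyclically\<close>
  define j where "j = (if i = 0 then ?n - 1 else i - 1)"
  define k where "k = (if i = ?n - 1 then 0 else i + 1)"
  have jk: "j < ?n" "k < ?n" "j \<noteq> k" using i p(2) by (auto simp: j_def k_def)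
  have fst_nth: "fst (p ! m) = snd (p ! (if m = 0 then ?n - 1 else m - 1))" if "m < ?n" for m
    using pcas_nth[OF p'(2) that] pcas_last[OF p'(2,4)] p'(4) by (auto simp: last_conv_nth)
  have "fst (p ! i) = snd (p ! j)" using fst_nth[OF i(1)] by (simp add: j_def)
  moreover have "(fst (p ! i), snd (p ! i)) \<in> parcs G" using p'(1) i(1) by auto
  ultimately have 1: "(v, snd (p ! j)) \<in> parcs G" using i(2) E by (auto dest: symD)
  have "fst (p ! k) = v" using fst_nth[OF jk(2)] i p(2) by (auto simp: k_def split: if_splits)
  moreover have "(fst (p ! k), snd (p ! k)) \<in> parcs G" using p'(1) jk(2) by auto
  ultimately have 2: "(v, snd (p ! k)) \<in> parcs G" by simp
  have "snd (p ! j) = snd (p ! k)"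
    by (rule v2[OF _ _ 1 2]) (use jk in auto)
  then show False using p'(3) jk nth_eq_iff_index_eq[of "map snd p" j k] by simp
qed

text \<open>
  If all members of \<open>S\<close> have two neighbours in \<open>S\<close>, consider a longest path in \<open>S\<close>. All
  neighbours of its first vertex lie on the path, and one of them is not the second vertex; it
  closes a cycle.
\<close>

lemma acyclic_one_degenerate:
  assumes G: "pair_graph G" and acyclic: "\<not> (\<exists>p. pre_digraph.cycle (with_proj G) p \<and> 3 \<le> length p)"
  shows "one_degenerate (parcs G) (pverts G)"
  unfolding one_degenerate_def
proof (intro allI impI, rule ccontr)
  have E: "finite (pverts G)" "parcs G \<subseteq> pverts G \<times> pverts G" "sym (parcs G)" "irrefl (parcs G)"
    using G by (auto simp: pair_graph_iff)
  fix S assume S: "S \<subseteq> pverts G" "S \<noteq> {}"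
    and "\<not> (\<exists>v\<in>S. \<forall>a\<in>S. \<forall>b\<in>S. (v, a) \<in> parcs G \<longrightarrow> (v, b) \<in> parcs G \<longrightarrow> a = b)"
  then have two: "\<exists>a\<in>S. \<exists>b\<in>S. (v, a) \<in> parcs G \<and> (v, b) \<in> parcs G \<and> a \<noteq> b" if "v \<in> S" for v
    using that by blast
  have finS: "finite S" using S(1) E(1) by (rule finite_subset)
  define path where "path xs \<longleftrightarrow> xs \<noteq> [] \<and> distinct xs \<and> set xs \<subseteq> S \<and>
    (\<forall>i. Suc i < length xs \<longrightarrow> (xs ! i, xs ! Suc i) \<in> parcs G)" for xs
  obtain s where "s \<in> S" using S by auto
  then have "path [s]" by (simp add: path_def)
  moreover have "length xs \<le> card S" if "path xs" for xs
    using that finS card_mono[of S "set xs"] by (auto simp: path_def distinct_card)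
  ultimately obtain xs where xs: "path xs" and longest: "\<And>ys. path ys \<Longrightarrow> length ys \<le> length xs"
    using ex_has_greatest_nat[of path "[s]" length "Suc (card S)"] by fastforce
  let ?x = "hd xs"
  have x: "?x \<in> S" "xs ! 0 = ?x" using xs by (auto simp: path_def hd_conv_nth)
  have on_path: "a \<in> set xs" if "a \<in> S" "(?x, a) \<in> parcs G" for a
  proof (rule ccontr)
    assume "a \<notin> set xs"
    have "path (a # xs)"
      unfolding path_def
    proof (intro conjI allI impI)
      fix i assume "Suc i < length (a # xs)"
      then show "((a # xs) ! i, (a # xs) ! Suc i) \<in> parcs G"
        using xs that x E(3) by (cases i) (auto simp: path_def dest: symD)
    qed (use xs that \<open>a \<notin> set xs\<close> in \<open>auto simp: path_def\<close>)
    from longest[OF this] show False by simp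
  qed
  have "\<exists>a\<in>S. (?x, a) \<in> parcs G \<and> (1 < length xs \<longrightarrow> a \<noteq> xs ! 1)"
    using two[OF x(1)] by metis
  then obtain a where a: "a \<in> S" "(?x, a) \<in> parcs G" "1 < length xs \<longrightarrow> a \<noteq> xs ! 1" by blast
  obtain j where j: "j < length xs" "xs ! j = a"
    using on_path[OF a(1,2)] by (auto simp: in_set_conv_nth)
  have "?x \<noteq> a" using a(2) E(4) by (auto simp: irrefl_def)
  then have "j \<noteq> 0" using j(2) x(2) by metis
  moreover have "j \<noteq> 1" using j a(3) by auto
  ultimately have j2: "2 \<le> j" by simp
  define ys where "ys = take (Suc j) xs"
  have ys: "length ys = Suc j" "distinct ys" "hd ys = ?x" "set ys \<subseteq> S" "ys \<noteq> []"
    "\<And>i. i < Suc j \<Longrightarrow> ys ! i = xs ! i"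
    using xs j(1) set_take_subset[of "Suc j" xs] by (auto simp: ys_def path_def)
  let ?p = "zip ys (tl ys @ [?x])"
  have len: "length (tl ys @ [?x]) = length ys" using ys(1) by simp
  have "pre_digraph.cycle (with_proj G) ?p"
    unfolding pre_digraph.cycle_def pre_digraph.awalk_def cas_with_proj_eq awalk_verts_with_proj_eq
  proof (intro exI[of _ ?x] conjI)
    show "?x \<in> verts (with_proj G)" using x S(1) by auto
    show pcas: "pcas ?x ?p ?x" using pcas_zip_tl[OF ys(5), of ?x] ys(3) by simp
    show "?p \<noteq> []" using ys(1) by (cases ys) auto
    have "map snd ?p = tl ys @ [hd ys]" using len ys(3) by simp
    moreover have "distinct (tl ys @ [hd ys])" using ys(2,5) by (cases ys) auto
    ultimately show "distinct (tl (pawalk_verts ?x ?p))" by (simp add: pawalk_verts_pcas[OF pcas])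
    show "set ?p \<subseteq> arcs (with_proj G)"
    proof
      fix e assume "e \<in> set ?p"
      then obtain i where i: "i < length ys" "e = (ys ! i, (tl ys @ [?x]) ! i)"
        using len by (auto simp: set_zip)
      show "e \<in> arcs (with_proj G)"
      proof (cases "i = j")
        case True
        then have "e = (a, ?x)" using i ys j by (simp add: nth_append)
        then show ?thesis using a(2) E(3) by (auto dest: symD)
      next
        case False
        then have i': "i < j" using i ys(1) by simp
        then have "e = (xs ! i, xs ! Suc i)" using i ys by (auto simp: nth_append nth_tl)
        then show ?thesis using xs i' j(1) by (auto simp: path_def)
      qed
    qed
  qed
  moreover have "3 \<le> length ?p" using ys(1) j2 len by simp
  ultimately show False using acyclic by blast
qed

lemma undirected_forest_iff:
  "undirected_forest G \<longleftrightarrow> pair_graph G \<and> one_degenerate (parcs G) (pverts G)"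
  using acyclic_one_degenerate[of G] cycle_not_one_degenerate[of G]
  by (auto simp: undirected_forest_def pair_graph_iff)

lemma undirected_tree_iff:
  "undirected_tree T \<longleftrightarrow> pair_graph T \<and> one_degenerate (parcs T) (pverts T) \<and> connected_in (parcs T) (pverts T)"
  using connected_in_iff_connected[of T]
  by (auto simp: undirected_tree_def undirected_forest_iff pair_graph_iff)

text \<open>
  A tree-decomposition of the graph that \<open>E\<close> induces on \<open>U\<close>. Edges leaving \<open>U\<close> are ignored, so
  the decomposed part can grow while \<open>E\<close> stays the same.
\<close>

definition decomposes :: "'a rel \<Rightarrow> 't pair_pre_digraph \<Rightarrow> ('t \<Rightarrow> 'a set) \<Rightarrow> 'a set \<Rightarrow> bool" where
  "decomposes E T X U \<longleftrightarrow> undirected_tree T \<and> (\<Union>t\<in>pverts T. X t) = U \<and>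
     (\<forall>x\<in>U. \<forall>y\<in>U. (x, y) \<in> E \<longrightarrow> (\<exists>t\<in>pverts T. x \<in> X t \<and> y \<in> X t)) \<and>
     (\<forall>v\<in>U. connected_in (parcs T) {t \<in> pverts T. v \<in> X t})"

lemma tree_decomposition_iff:
  assumes "pair_graph G"
  shows "tree_decomposition G T X \<longleftrightarrow> decomposes (parcs G) T X (pverts G)"
proof (cases "undirected_tree T")
  case True
  then have "sym (parcs T)" by (simp add: undirected_tree_iff pair_graph_iff)
  moreover have "(\<forall>(u, v)\<in>parcs G. P u v) \<longleftrightarrow> (\<forall>u\<in>pverts G. \<forall>v\<in>pverts G. (u, v) \<in> parcs G \<longrightarrow> P u v)" for P
    using assms by (auto simp: pair_graph_iff)
  ultimately show ?thesis
    using True by (simp add: tree_decomposition_def decomposes_def connected_in_iff_connected_induced)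
next
  case False
  then show ?thesis by (simp add: tree_decomposition_def decomposes_def)
qed

text \<open>
  A new leaf preserves \<open>one_degenerate\<close>, as the leaf itself is the required vertex of any set
  that contains it. This makes leaves the convenient step for building trees.
\<close>

lemma decomposes_add_leaf:
  assumes "sym E" and dec: "decomposes E T X U" and t: "t \<in> pverts T" and n: "n \<notin> pverts T"
    and R: "R \<inter> U \<subseteq> X t" "\<forall>x\<in>U - R. \<forall>y\<in>R - U. (x, y) \<notin> E"
  shows "decomposes E \<lparr>pverts = insert n (pverts T), parcs = parcs T \<union> {(t, n), (n, t)}\<rparr>
    (X(n := R)) (U \<union> R)" (is "decomposes E ?T ?X _")
proof -
  have T: "finite (pverts T)" "parcs T \<subseteq> pverts T \<times> pverts T" "sym (parcs T)" "irrefl (parcs T)"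
    "one_degenerate (parcs T) (pverts T)" "connected_in (parcs T) (pverts T)"
    and UX: "(\<Union>t\<in>pverts T. X t) = U"
    and edges: "\<And>x y. x \<in> U \<Longrightarrow> y \<in> U \<Longrightarrow> (x, y) \<in> E \<Longrightarrow> \<exists>t\<in>pverts T. x \<in> X t \<and> y \<in> X t"
    and conn: "\<And>v. v \<in> U \<Longrightarrow> connected_in (parcs T) {t \<in> pverts T. v \<in> X t}"
    using dec by (auto simp: decomposes_def undirected_tree_iff pair_graph_iff)
  have X: "?X s = X s" if "s \<in> pverts T" for s using that n by auto
  have symT: "sym (parcs ?T)" using T(3) by (auto simp: sym_def)
  have sub: "parcs T \<subseteq> parcs ?T" by auto
  have "t \<noteq> n" using t n by auto
  have add: "connected_in (parcs ?T) (insert n A)" if "connected_in (parcs T) A" "t \<in> A" for A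
  proof -
    have "connected_in (parcs ?T) (A \<union> {n})"
      by (rule connected_in_Un[OF symT connected_in_mono[OF that(1) sub] connected_in_singleton])
        (use that(2) in auto)
    then show ?thesis by simp
  qed
  have "parcs ?T \<subseteq> pverts ?T \<times> pverts ?T" using T(2) t by auto
  moreover have "irrefl (parcs ?T)" using T(4) \<open>t \<noteq> n\<close> by (auto simp: irrefl_def)
  ultimately have "pair_graph ?T"
    using T(1) symT unfolding pair_graph_iff by simp
  moreover have "one_degenerate (parcs ?T) (pverts ?T)"
    unfolding one_degenerate_def
  proof (intro allI impI)
    fix S assume S: "S \<subseteq> pverts ?T" "S \<noteq> {}"
    show "\<exists>v\<in>S. \<forall>a\<in>S. \<forall>b\<in>S. (v, a) \<in> parcs ?T \<longrightarrow> (v, b) \<in> parcs ?T \<longrightarrow> a = b"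
    proof (cases "n \<in> S")
      case True
      have "\<forall>a. (n, a) \<in> parcs ?T \<longrightarrow> a = t" using T(2) n by auto
      with True show ?thesis by blast
    next
      case False
      then have "S \<subseteq> pverts T" using S by auto
      from one_degenerateD[OF T(5) this S(2)] obtain v where v: "v \<in> S"
        "\<forall>a\<in>S. \<forall>b\<in>S. (v, a) \<in> parcs T \<longrightarrow> (v, b) \<in> parcs T \<longrightarrow> a = b" by (rule bexE)
      moreover have "(v, a) \<in> parcs T" if "(v, a) \<in> parcs ?T" "a \<in> S" for a
        using that False v(1) by auto
      ultimately show ?thesis by blast
    qed
  qed
  moreover have "connected_in (parcs ?T) (pverts ?T)" using add[OF T(6) t] by simp
  ultimately have tree: "undirected_tree ?T" by (simp add: undirected_tree_iff)
  show ?thesis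
    unfolding decomposes_def
  proof (intro conjI ballI impI)
    show "undirected_tree ?T" by (rule tree)
    show "(\<Union>t\<in>pverts ?T. ?X t) = U \<union> R" using UX n by auto
  next
    fix x y assume xy: "x \<in> U \<union> R" "y \<in> U \<union> R" "(x, y) \<in> E"
    have "(y, x) \<in> E" using xy(3) assms(1) by (simp add: symD)
    then have "x \<in> U \<and> y \<in> U \<or> x \<in> R \<and> y \<in> R" using R(2) xy by blast
    then show "\<exists>t\<in>pverts ?T. x \<in> ?X t \<and> y \<in> ?X t"
    proof
      assume "x \<in> U \<and> y \<in> U"
      then obtain s where "s \<in> pverts T" "x \<in> X s" "y \<in> X s" using edges xy(3) by blast
      then show ?thesis using X by (intro bexI[of _ s]) auto
    next
      assume "x \<in> R \<and> y \<in> R"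
      then show ?thesis by (intro bexI[of _ n]) auto
    qed
  next
    fix v assume v: "v \<in> U \<union> R"
    show "connected_in (parcs ?T) {t \<in> pverts ?T. v \<in> ?X t}"
    proof (cases "v \<in> R")
      case False
      then have "{t \<in> pverts ?T. v \<in> ?X t} = {t \<in> pverts T. v \<in> X t}" using n by auto
      then show ?thesis using connected_in_mono[OF conn sub] v False by auto
    next
      case True
      then have eq: "{t \<in> pverts ?T. v \<in> ?X t} = insert n {t \<in> pverts T. v \<in> X t}" using n by auto
      show ?thesis
      proof (cases "v \<in> U")
        case True
        show ?thesis unfolding eq by (rule add[OF conn[OF True]]) (use True t R(1) \<open>v \<in> R\<close> in auto)
      next
        case False
        then have none: "{t \<in> pverts T. v \<in> X t} = {}" using UX by auto
        show ?thesis unfolding eq none by (rule connected_in_singleton)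
      qed
    qed
  qed
qed

text \<open>
  The induction hangs the new decomposition below a node \<open>t\<close> of a tree that already exists. That
  tree and its bags must persist, because in the case of a join the second part is attached at
  the root of the first.
\<close>

lemma rooted_td_realise:
  fixes T :: "nat pair_pre_digraph"
  assumes "sym E" "rooted_td E U2 R \<R>"
    and "decomposes E T X U1" "t \<in> pverts T" "U1 \<inter> U2 \<subseteq> X t \<inter> R"
    and "\<forall>x\<in>U1 - U2. \<forall>y\<in>U2 - U1. (x, y) \<notin> E"
  shows "\<exists>T' X' r. decomposes E (T' :: nat pair_pre_digraph) X' (U1 \<union> U2) \<and> pverts T \<subseteq> pverts T' \<and>
    (\<forall>s\<in>pverts T. X' s = X s) \<and> r \<in> pverts T' \<and> X' r = R \<and> X' ` pverts T' = X ` pverts T \<union> \<R>"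
  using assms(2-6)
proof (induct arbitrary: T X U1 t rule: rooted_td.induct)
  case (single R)
  have "finite (pverts T)"
    using single(1) by (simp add: decomposes_def undirected_tree_iff pair_graph_iff)
  then obtain n where n: "n \<notin> pverts T" using ex_new_if_finite[OF infinite_UNIV_nat] by auto
  let ?T = "\<lparr>pverts = insert n (pverts T), parcs = parcs T \<union> {(t, n), (n, t)}\<rparr>" and ?X = "X(n := R)"
  have "decomposes E ?T ?X (U1 \<union> R)"
    by (rule decomposes_add_leaf[OF assms(1) single(1,2) n]) (use single(3,4) in auto)
  moreover have "?X ` pverts ?T = X ` pverts T \<union> {R}" "\<forall>s\<in>pverts T. ?X s = X s" using n by auto
  moreover have "pverts T \<subseteq> pverts ?T" "n \<in> pverts ?T" "?X n = R" by auto
  ultimately show ?case by (intro exI[of _ ?T] exI[of _ ?X] exI[of _ n] conjI)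
next
  case (join Ua Ra \<R>a Ub Rb \<R>b)
  have sub: "Ra \<subseteq> Ua" by (rule rooted_td_bag_subset[OF join(1) rooted_td_root[OF join(1)]])
  have "\<exists>T' X' r. decomposes E (T' :: nat pair_pre_digraph) X' (U1 \<union> Ua) \<and> pverts T \<subseteq> pverts T' \<and>
    (\<forall>s\<in>pverts T. X' s = X s) \<and> r \<in> pverts T' \<and> X' r = Ra \<and> X' ` pverts T' = X ` pverts T \<union> \<R>a"
    by (rule join(2)[OF join(7,8)]) (use join(9,10) sub in blast)+
  then obtain T' :: "nat pair_pre_digraph" and X' r where
    T': "decomposes E T' X' (U1 \<union> Ua)" "pverts T \<subseteq> pverts T'" "\<forall>s\<in>pverts T. X' s = X s"
      "r \<in> pverts T'" "X' r = Ra" "X' ` pverts T' = X ` pverts T \<union> \<R>a"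
    by (elim exE conjE) (rule that)
  have "\<exists>T'' X'' r'. decomposes E (T'' :: nat pair_pre_digraph) X'' ((U1 \<union> Ua) \<union> Ub) \<and> pverts T' \<subseteq> pverts T'' \<and>
    (\<forall>s\<in>pverts T'. X'' s = X' s) \<and> r' \<in> pverts T'' \<and> X'' r' = Rb \<and> X'' ` pverts T'' = X' ` pverts T' \<union> \<R>b"
  proof (rule join(4)[OF T'(1,4)])
    show "(U1 \<union> Ua) \<inter> Ub \<subseteq> X' r \<inter> Rb" using T'(5) join(5,9) sub by blast
    show "\<forall>x\<in>U1 \<union> Ua - Ub. \<forall>y\<in>Ub - (U1 \<union> Ua). (x, y) \<notin> E" using join(6,10) by blast
  qed
  then obtain T'' :: "nat pair_pre_digraph" and X'' where
    T'': "decomposes E T'' X'' ((U1 \<union> Ua) \<union> Ub)" "pverts T' \<subseteq> pverts T''"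
      "\<forall>s\<in>pverts T'. X'' s = X' s" "X'' ` pverts T'' = X' ` pverts T' \<union> \<R>b"
    by (elim exE conjE) (rule that)
  show ?case
  proof (intro exI conjI)
    show "decomposes E T'' X'' (U1 \<union> (Ua \<union> Ub))" using T''(1) by (simp add: Un_assoc)
    show "pverts T \<subseteq> pverts T''" using T'(2) T''(2) by auto
    show "\<forall>s\<in>pverts T. X'' s = X s" using T'(2,3) T''(3) by auto
    show "r \<in> pverts T''" "X'' r = Ra" using T'(4,5) T''(2,3) by auto
    show "X'' ` pverts T'' = X ` pverts T \<union> (\<R>a \<union> \<R>b)" using T'(6) T''(4) by auto
  qed
qed

section \<open>Bounding the tree-width\<close>

text \<open>
  The integers are not well-ordered, so a least element needs a lower bound.
\<close>

lemma int_Least: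
  fixes P :: "int \<Rightarrow> bool"
  assumes "P x" "\<And>y. P y \<Longrightarrow> b \<le> y"
  shows "P (Least P)" "\<And>y. P y \<Longrightarrow> Least P \<le> y"
proof -
  obtain z where z: "P z" "\<And>y. P y \<Longrightarrow> nat (z - b) \<le> nat (y - b)"
    using ex_has_least_nat[of P x "\<lambda>y. nat (y - b)"] assms(1) by auto
  have least: "z \<le> y" if "P y" for y using z(2)[OF that] assms(2)[OF that] assms(2)[OF z(1)] by auto
  then have "Least P = z" using z(1) by (intro Least_equality)
  then show "P (Least P)" "\<And>y. P y \<Longrightarrow> Least P \<le> y" using z(1) least by auto
qed

lemma decomposition_width_bounds:
  assumes "undirected_tree T"
  shows "- 1 \<le> decomposition_width T X"
    and "t \<in> pverts T \<Longrightarrow> int (card (X t)) - 1 \<le> decomposition_width T X"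
    and "(\<And>t. t \<in> pverts T \<Longrightarrow> card (X t) \<le> w) \<Longrightarrow> decomposition_width T X \<le> int w - 1"
proof -
  have T: "finite (pverts T)" "pverts T \<noteq> {}"
    using assms connected_in_nonempty by (auto simp: undirected_tree_iff pair_graph_iff)
  show 1: "int (card (X t)) - 1 \<le> decomposition_width T X" if "t \<in> pverts T" for t
    unfolding decomposition_width_def
    by (rule diff_right_mono, rule Max_ge) (use T that in auto)
  obtain t where "t \<in> pverts T" using T by auto
  from 1[OF this] show "- 1 \<le> decomposition_width T X" by simp
  show "decomposition_width T X \<le> int w - 1" if "\<And>t. t \<in> pverts T \<Longrightarrow> card (X t) \<le> w"
    unfolding decomposition_width_def
    by (rule diff_right_mono, rule Max.boundedI) (use T that in auto)
qed

lemma exists_decomposition: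
  assumes G: "pair_graph G" and td: "rooted_td (parcs G) (pverts G) R \<R>" "\<And>Q. Q \<in> \<R> \<Longrightarrow> card Q \<le> w"
  shows "\<exists>(T :: nat pair_pre_digraph) X. tree_decomposition G T X \<and> decomposition_width T X \<le> int w - 1"
proof -
  \<comment> \<open>the realisation grows from a single node; its empty bag does not affect the width\<close>
  let ?T0 = "\<lparr>pverts = {0}, parcs = {}\<rparr> :: nat pair_pre_digraph" and ?X0 = "\<lambda>_. {}"
  have "undirected_tree ?T0"
    by (auto simp: undirected_tree_iff pair_graph_iff one_degenerate_def connected_in_singleton sym_def irrefl_def)
  then have dec0: "decomposes (parcs G) ?T0 ?X0 {}" by (simp add: decomposes_def)
  have sym: "sym (parcs G)" using G by (simp add: pair_graph_iff)
  obtain T' :: "nat pair_pre_digraph" and X' where T': "decomposes (parcs G) T' X' (pverts G)"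
    "X' ` pverts T' = {{}} \<union> \<R>"
    using rooted_td_realise[OF sym td(1) dec0, of 0] by auto
  have "card (X' t) \<le> w" if "t \<in> pverts T'" for t
  proof -
    have "X' t \<in> {{}} \<union> \<R>" using T'(2) that by blast
    then show ?thesis using td(2) by auto
  qed
  then have "decomposition_width T' X' \<le> int w - 1"
    using T'(1) by (intro decomposition_width_bounds(3)) (auto simp: decomposes_def)
  then show ?thesis using T'(1) G by (auto simp: tree_decomposition_iff)
qed

lemma treewidth_least:
  assumes "pair_graph G"
  shows "\<exists>(T :: nat pair_pre_digraph) X. tree_decomposition G T X \<and> treewidth G = decomposition_width T X"
    and "\<And>(T :: nat pair_pre_digraph) X. tree_decomposition G T X \<Longrightarrow> treewidth G \<le> decomposition_width T X"
proof -
  let ?P = "\<lambda>w. \<exists>(T :: nat pair_pre_digraph) X. tree_decomposition G T X \<and> w = decomposition_width T X"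
  obtain T :: "nat pair_pre_digraph" and X where TX: "tree_decomposition G T X"
    using exists_decomposition[OF assms rooted_td.single, of "card (pverts G)"] by auto
  have b: "- 1 \<le> y" if "?P y" for y
    using that decomposition_width_bounds(1) by (auto simp: tree_decomposition_def)
  have "?P (decomposition_width T X)" using TX by blast
  from int_Least[of ?P, OF this b]
  show "?P (treewidth G)"
    and "\<And>(T :: nat pair_pre_digraph) X. tree_decomposition G T X \<Longrightarrow> treewidth G \<le> decomposition_width T X"
    unfolding treewidth_def by blast+
qed

lemma connected_in_remove_leaf:
  assumes "connected_in E P" "sym E" "\<And>a b. a \<in> P \<Longrightarrow> b \<in> P \<Longrightarrow> (l, a) \<in> E \<Longrightarrow> (l, b) \<in> E \<Longrightarrow> a = b"
    and "P - {l} \<noteq> {}"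
  shows "connected_in E (P - {l})"
proof (rule connected_inI[OF assms(4)])
  fix a Q assume a: "a \<in> P - {l}" "a \<in> Q" "Q \<subseteq> P - {l}"
    and Q: "\<And>u v. u \<in> Q \<Longrightarrow> v \<in> P - {l} \<Longrightarrow> (u, v) \<in> E \<Longrightarrow> v \<in> Q"
  \<comment> \<open>the leaf joins \<open>Q\<close> only if its neighbour is already there, so nothing else can be reached through it\<close>
  define Q' where "Q' = Q \<union> {x. x = l \<and> (\<exists>q\<in>Q. (l, q) \<in> E)}"
  have "P \<subseteq> Q'"
  proof (rule connected_in_subset[OF assms(1)])
    show "a \<in> P" "a \<in> Q'" using a by (auto simp: Q'_def)
    fix u v assume uv: "u \<in> P" "u \<in> Q'" "v \<in> P" "(u, v) \<in> E"
    show "v \<in> Q'"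
    proof (cases "u \<in> Q")
      case True
      then show ?thesis using Q[of u v] uv assms(2) by (cases "v = l") (auto simp: Q'_def dest: symD)
    next
      case False
      then obtain q where q: "u = l" "q \<in> Q" "(l, q) \<in> E" using uv(2) by (auto simp: Q'_def)
      then have "v = q" using assms(3)[of v q] uv a(3) by auto
      then show ?thesis using q by (simp add: Q'_def)
    qed
  qed
  then show "P - {l} \<subseteq> Q" by (auto simp: Q'_def)
qed

text \<open>
  Remove a leaf \<open>l\<close> of the tree. A subtree equal to \<open>{l}\<close> forces \<open>l\<close> to be common to all
  subtrees. Otherwise every subtree that contains \<open>l\<close> also contains its only neighbour, so the
  subtrees stay connected and still meet in pairs.
\<close>

theorem subtrees_helly:
  assumes "finite N" "one_degenerate E N" "sym E" "K \<noteq> {}"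
    and "\<And>v. v \<in> K \<Longrightarrow> connected_in E (S v) \<and> S v \<subseteq> N"
    and "\<And>u v. u \<in> K \<Longrightarrow> v \<in> K \<Longrightarrow> S u \<inter> S v \<noteq> {}"
  shows "\<exists>t\<in>N. \<forall>v\<in>K. t \<in> S v"
  using assms
proof (induct "card N" arbitrary: N S rule: less_induct)
  case (less N S)
  note S = less.prems(5) and meet = less.prems(6)
  obtain v0 where "v0 \<in> K" using less.prems(4) by auto
  then have "N \<noteq> {}" using S[of v0] connected_in_nonempty[of E "S v0"] by auto
  from one_degenerateD[OF less.prems(2) order_refl \<open>N \<noteq> {}\<close>] obtain l where l: "l \<in> N"
    and "\<forall>a\<in>N. \<forall>b\<in>N. (l, a) \<in> E \<longrightarrow> (l, b) \<in> E \<longrightarrow> a = b" by (rule bexE)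
  then have leaf: "\<And>a b. a \<in> N \<Longrightarrow> b \<in> N \<Longrightarrow> (l, a) \<in> E \<Longrightarrow> (l, b) \<in> E \<Longrightarrow> a = b" by simp
  show ?case
  proof (cases "\<exists>v\<in>K. S v = {l}")
    case True
    then obtain v where v: "v \<in> K" "S v = {l}" by auto
    have "l \<in> S u" if "u \<in> K" for u using meet[OF that v(1)] v(2) by auto
    then show ?thesis using l by auto
  next
    case False
    then have ne: "S v - {l} \<noteq> {}" if "v \<in> K" for v
      using S[OF that] connected_in_nonempty[of E "S v"] that by blast
    have nbr: "\<exists>p\<in>S v - {l}. (l, p) \<in> E" if "v \<in> K" "l \<in> S v" for v
    proof (rule ccontr)
      assume *: "\<not> ?thesis"
      have "S v \<subseteq> {l}"
        by (rule connected_in_subset[of E _ l]) (use S[OF that(1)] that(2) * in auto)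
      then show False using ne[OF that(1)] by auto
    qed
    have "\<exists>t\<in>N - {l}. \<forall>v\<in>K. t \<in> S v - {l}"
    proof (rule less.hyps)
      show "card (N - {l}) < card N" using l less.prems(1) by (intro psubset_card_mono) auto
      show "one_degenerate E (N - {l})" using one_degenerate_restrict[OF less.prems(2), of "N - {l}" UNIV E] by auto
      fix v assume v: "v \<in> K"
      have "connected_in E (S v - {l})"
      proof (rule connected_in_remove_leaf[OF _ less.prems(3) _ ne[OF v]])
        show "connected_in E (S v)" using S[OF v] by simp
        show "a = b" if "a \<in> S v" "b \<in> S v" "(l, a) \<in> E" "(l, b) \<in> E" for a b
          by (rule leaf[OF _ _ that(3,4)]) (use that S[OF v] in auto)
      qed
      then show "connected_in E (S v - {l}) \<and> S v - {l} \<subseteq> N - {l}" using S[OF v] by auto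
    next
      fix u v assume uv: "u \<in> K" "v \<in> K"
      show "(S u - {l}) \<inter> (S v - {l}) \<noteq> {}"
      proof (cases "l \<in> S u \<and> l \<in> S v")
        case True
        obtain p where p: "p \<in> S u - {l}" "(l, p) \<in> E" using nbr[OF uv(1)] True by auto
        obtain q where q: "q \<in> S v - {l}" "(l, q) \<in> E" using nbr[OF uv(2)] True by auto
        have "p = q" using leaf[of p q] p q S[OF uv(1)] S[OF uv(2)] by auto
        then show ?thesis using p q by auto
      next
        case False
        then show ?thesis using meet[OF uv] by auto
      qed
    qed (use less.prems in auto)
    then obtain t where "t \<in> N - {l}" "\<forall>v\<in>K. t \<in> S v - {l}" by (rule bexE)
    then show ?thesis by (intro bexI[of _ t]) auto
  qed
qed

definition complete_graph :: "nat \<Rightarrow> nat pair_pre_digraph" where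
  "complete_graph m = \<lparr>pverts = {..<m}, parcs = {(i, j). i < m \<and> j < m \<and> i \<noteq> j}\<rparr>"

lemma pair_graph_complete_graph: "pair_graph (complete_graph m)"
  by (auto simp: complete_graph_def pair_graph_iff sym_def irrefl_def)

text \<open>
  The nodes whose bags contain a given vertex form a subtree, and two of these meet because the
  two vertices are adjacent. A common node has a bag that contains everything.
\<close>

lemma treewidth_complete_graph: "int m - 1 \<le> treewidth (complete_graph m)"
proof -
  let ?G = "complete_graph m"
  obtain T :: "nat pair_pre_digraph" and X where td: "tree_decomposition ?G T X"
    and tw: "treewidth ?G = decomposition_width T X"
    using treewidth_least(1)[OF pair_graph_complete_graph] by blast
  have dec: "decomposes (parcs ?G) T X (pverts ?G)"
    using td pair_graph_complete_graph by (simp add: tree_decomposition_iff)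
  then have T: "undirected_tree T" by (simp add: decomposes_def)
  show ?thesis
  proof (cases "m = 0")
    case True
    then show ?thesis using tw decomposition_width_bounds(1)[OF T] by simp
  next
    case False
    let ?S = "\<lambda>v. {t \<in> pverts T. v \<in> X t}"
    have conn: "connected_in (parcs T) (?S v)" if "v < m" for v
      using dec that by (simp add: decomposes_def complete_graph_def)
    have edge: "\<exists>t\<in>pverts T. u \<in> X t \<and> v \<in> X t" if "u < m" "v < m" "u \<noteq> v" for u v
      using dec that by (simp add: decomposes_def complete_graph_def)
    have "\<exists>t\<in>pverts T. \<forall>v\<in>{..<m}. t \<in> ?S v"
    proof (rule subtrees_helly)
      show "finite (pverts T)" "one_degenerate (parcs T) (pverts T)" "sym (parcs T)"
        using T by (auto simp: undirected_tree_iff pair_graph_iff)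
      fix u v assume "u \<in> {..<m}" "v \<in> {..<m}"
      then show "?S u \<inter> ?S v \<noteq> {}"
        using connected_in_nonempty[OF conn[of u]] edge[of u v] by (cases "u = v") auto
    next
      fix v assume "v \<in> {..<m}"
      then show "connected_in (parcs T) (?S v) \<and> ?S v \<subseteq> pverts T" using conn by auto
    qed (use False in auto)
    then obtain t where t: "t \<in> pverts T" "{..<m} \<subseteq> X t" by auto
    have "X t \<subseteq> {..<m}" using dec t(1) by (auto simp: decomposes_def complete_graph_def)
    with t(2) have "X t = {..<m}" by auto
    then show ?thesis using decomposition_width_bounds(2)[OF T t(1), of X] tw by simp
  qed
qed

section \<open>Minors from branch sets\<close>

lemma has_minor_step: "minor_step G G' \<Longrightarrow> has_minor G' H \<Longrightarrow> has_minor G H"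
  unfolding has_minor_def by (meson converse_rtranclp_into_rtranclp)

text \<open>
  Only edges have to be deleted, those that are not images of edges of \<open>H\<close>.
\<close>

lemma has_minor_spanning_subgraph:
  assumes "pair_graph G" "pair_graph H" "bij_betw b (pverts H) (pverts G)"
    and "\<And>x y. (x, y) \<in> parcs H \<Longrightarrow> (b x, b y) \<in> parcs G"
  shows "has_minor G H"
  using assms
proof (induct "card (parcs G)" arbitrary: G rule: less_induct)
  case (less G)
  note G = less.prems(1) and H = less.prems(2) and b = less.prems(3) and edges = less.prems(4)
  let ?F = "map_prod b b ` parcs H"
  have inj: "inj_on b (pverts H)" using b by (simp add: bij_betw_def)
  have F_sub: "?F \<subseteq> parcs G" using edges by auto
  show ?case
  proof (cases "parcs G = ?F")
    case True
    let ?h = "\<lparr>iso_verts = b, iso_arcs = map_prod b b, iso_head = snd, iso_tail = fst\<rparr>"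
    have wf: "wf_digraph (with_proj H)"
      using H by (simp add: wf_digraph_wp_iff pair_graph_def pair_digraph_def pair_fin_digraph_def)
    have "inj_on (map_prod b b) (pverts H \<times> pverts H)"
      using inj by (intro map_prod_inj_on)
    then have "inj_on (map_prod b b) (parcs H)"
      by (rule inj_on_subset) (use H in \<open>simp add: pair_graph_iff\<close>)
    then have "pre_digraph.digraph_isomorphism (with_proj H) ?h"
      using wf inj by (auto simp: pre_digraph.digraph_isomorphism_def)
    moreover have "with_proj G = app_iso ?h (with_proj H)"
      using b True by (simp add: app_iso_def with_proj_def bij_betw_def)
    ultimately have "digraph_iso (with_proj H) (with_proj G)" by (auto simp: digraph_iso_def)
    then show ?thesis by (auto simp: has_minor_def)
  next
    case False
    then obtain u v where uv: "(u, v) \<in> parcs G" "(u, v) \<notin> ?F" using F_sub by auto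
    let ?G = "delete_edge G u v"
    have step: "minor_step G ?G" by (rule edge_deletion[OF uv(1)])
    have "finite (parcs G)"
      using G by (auto simp: pair_graph_iff intro: finite_subset)
    then have "card (parcs ?G) < card (parcs G)"
      using uv(1) by (intro psubset_card_mono) (auto simp: delete_edge_def)
    moreover have "(b x, b y) \<in> parcs ?G" if "(x, y) \<in> parcs H" for x y
    proof -
      have "(y, x) \<in> parcs H" using H that by (auto simp: pair_graph_iff dest: symD)
      then have "(b y, b x) \<noteq> (u, v)" "(b x, b y) \<noteq> (u, v)" using that uv(2) by force+
      then show ?thesis using edges[OF that] by (auto simp: delete_edge_def)
    qed
    moreover have "bij_betw b (pverts H) (pverts ?G)" using b by (simp add: delete_edge_def)
    ultimately have "has_minor ?G H" using less.hyps[OF _ pair_graph_minor_step[OF step G] H] by blast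
    then show ?thesis by (rule has_minor_step[OF step])
  qed
qed

lemma connected_in_image:
  assumes "connected_in E P" "\<And>x y. x \<in> P \<Longrightarrow> y \<in> P \<Longrightarrow> (x, y) \<in> E \<Longrightarrow> r x = r y \<or> (r x, r y) \<in> E'"
  shows "connected_in E' (r ` P)"
proof (rule connected_inI)
  show "r ` P \<noteq> {}" using connected_in_nonempty[OF assms(1)] by auto
next
  fix a Q assume a: "a \<in> r ` P" "a \<in> Q" and Q: "\<And>u v. u \<in> Q \<Longrightarrow> v \<in> r ` P \<Longrightarrow> (u, v) \<in> E' \<Longrightarrow> v \<in> Q"
  obtain x where x: "x \<in> P" "r x = a" using a(1) by auto
  have "P \<subseteq> {z. r z \<in> Q}"
    by (rule connected_in_subset[OF assms(1) x(1)]) (use x a(2) Q assms(2) in \<open>force\<close>)+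
  then show "r ` P \<subseteq> Q" by auto
qed

text \<open>
  Delete a vertex outside all branch sets, or contract an edge inside one of them. When neither
  is possible, the branch sets are single vertices that exhaust the graph.
\<close>

theorem has_minor_of_branch_sets:
  assumes "pair_graph G" "pair_graph H" "branch_sets (parcs G) (parcs H) (pverts H) M"
    and "\<And>h. h \<in> pverts H \<Longrightarrow> M h \<subseteq> pverts G"
  shows "has_minor G H"
  using assms
proof (induct "card (pverts G)" arbitrary: G M rule: less_induct)
  case (less G M)
  note G = less.prems(1) and H = less.prems(2)
  have finG: "finite (pverts G)" and symG: "sym (parcs G)" and irrG: "irrefl (parcs G)"
    and EG: "parcs G \<subseteq> pverts G \<times> pverts G"
    using G by (auto simp: pair_graph_iff)
  have irrH: "irrefl (parcs H)" and EH: "parcs H \<subseteq> pverts H \<times> pverts H"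
    using H by (auto simp: pair_graph_iff)
  have con: "connected_in (parcs G) (M h)" and sub: "M h \<subseteq> pverts G" if "h \<in> pverts H" for h
    using less.prems(3,4) that by (auto simp: branch_sets_def)
  have disj: "M h \<inter> M g = {}" if "h \<in> pverts H" "g \<in> pverts H" "h \<noteq> g" for h g
    using less.prems(3) that by (auto simp: branch_sets_def disjoint_family_on_def)
  have edges: "\<exists>x\<in>M f. \<exists>y\<in>M g. (x, y) \<in> parcs G" if "(f, g) \<in> parcs H" for f g
    using less.prems(3) that EH by (auto simp: branch_sets_def)
  consider (delete) v where "v \<in> pverts G" "\<And>h. h \<in> pverts H \<Longrightarrow> v \<notin> M h"
    | (contract) h u v where "h \<in> pverts H" "u \<in> M h" "v \<in> M h" "(u, v) \<in> parcs G"
    | (spanning) "pverts G \<subseteq> (\<Union>h\<in>pverts H. M h)"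
        "\<And>h u v. h \<in> pverts H \<Longrightarrow> u \<in> M h \<Longrightarrow> v \<in> M h \<Longrightarrow> (u, v) \<notin> parcs G"
    by blast
  then show ?case
  proof cases
    case (delete v)
    let ?G = "delete_vertex G v"
    have step: "minor_step G ?G" by (rule vertex_deletion[OF delete(1)])
    have arcs: "parcs G \<inter> (- {v}) \<times> (- {v}) = parcs ?G" by (auto simp: delete_vertex_def)
    have "connected_in (parcs ?G) (M h)" if "h \<in> pverts H" for h
      unfolding arcs[symmetric] by (rule connected_in_restrict[OF con[OF that]]) (use delete(2)[OF that] in auto)
    moreover have "\<exists>x\<in>M f. \<exists>y\<in>M g. (x, y) \<in> parcs ?G" if fg: "(f, g) \<in> parcs H" for f g
    proof -
      obtain x y where "x \<in> M f" "y \<in> M g" "(x, y) \<in> parcs G" using edges[OF fg] by auto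
      moreover from this have "x \<noteq> v" "y \<noteq> v" using delete(2) fg EH by auto
      ultimately show ?thesis by (auto simp: delete_vertex_def)
    qed
    ultimately have "branch_sets (parcs ?G) (parcs H) (pverts H) M"
      using disj by (auto simp: branch_sets_def disjoint_family_on_def)
    moreover have "card (pverts ?G) < card (pverts G)"
      using finG delete(1) by (intro psubset_card_mono) (auto simp: delete_vertex_def)
    moreover have "M h \<subseteq> pverts ?G" if "h \<in> pverts H" for h
      using sub[OF that] delete(2)[OF that] by (auto simp: delete_vertex_def)
    ultimately have "has_minor ?G H" using less.hyps[OF _ pair_graph_minor_step[OF step G] H] by blast
    then show ?thesis by (rule has_minor_step[OF step])
  next
    case (contract h u v)
    let ?G = "contract_edge G u v"
    have step: "minor_step G ?G" by (rule edge_contraction[OF contract(4)])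
    have uv: "u \<noteq> v" using irrG contract(4) by (auto simp: irrefl_def)
    define r where "r = (\<lambda>x. if x = v then u else x)"
    define N where "N g = r ` M g" for g
    have arcs: "(r x, r y) \<in> parcs ?G" if "(x, y) \<in> parcs G" "r x \<noteq> r y" for x y
    proof -
      have "parcs ?G = {(r x, r y) |x y. (x, y) \<in> parcs G \<and> r x \<noteq> r y}"
        by (simp add: contract_edge_def Let_def r_def)
      with that show ?thesis by blast
    qed
    have N: "N g = M g - {v}" if "g \<in> pverts H" for g
    proof (cases "g = h")
      case True
      then show ?thesis using contract uv by (auto simp: N_def r_def image_iff)
    next
      case False
      then have "v \<notin> M g" using disj[OF that contract(1)] contract(3) by auto
      then show ?thesis by (auto simp: N_def r_def image_iff)
    qed
    have disjN: "N f \<inter> N g = {}" if "f \<in> pverts H" "g \<in> pverts H" "f \<noteq> g" for f g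
      using disj[OF that] N[OF that(1)] N[OF that(2)] by auto
    have "connected_in (parcs ?G) (N g)" if "g \<in> pverts H" for g
      unfolding N_def
    proof (rule connected_in_image[OF con[OF that]])
      show "r x = r y \<or> (r x, r y) \<in> parcs ?G" if "(x, y) \<in> parcs G" for x y
        using arcs[OF that] by (cases "r x = r y") simp_all
    qed
    moreover have "\<exists>x\<in>N f. \<exists>y\<in>N g. (x, y) \<in> parcs ?G" if fg: "(f, g) \<in> parcs H" for f g
    proof -
      obtain x y where xy: "x \<in> M f" "y \<in> M g" "(x, y) \<in> parcs G" using edges[OF fg] by auto
      have "f \<noteq> g" "f \<in> pverts H" "g \<in> pverts H" using fg irrH EH by (auto simp: irrefl_def)
      then have "r x \<noteq> r y" using disjN[of f g] xy by (auto simp: N_def)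
      then show ?thesis using arcs[OF xy(3)] xy(1,2) by (auto simp: N_def)
    qed
    ultimately have "branch_sets (parcs ?G) (parcs H) (pverts H) N"
      using disjN by (auto simp: branch_sets_def disjoint_family_on_def)
    moreover have "card (pverts ?G) < card (pverts G)"
      using finG contract(4) EG by (intro psubset_card_mono) (auto simp: contract_edge_def Let_def)
    moreover have "N g \<subseteq> pverts ?G" if "g \<in> pverts H" for g
      using sub[OF that] N[OF that] by (auto simp: contract_edge_def Let_def)
    ultimately have "has_minor ?G H" using less.hyps[OF _ pair_graph_minor_step[OF step G] H] by blast
    then show ?thesis by (rule has_minor_step[OF step])
  next
    case spanning
    have "\<exists>x. M h = {x}" if h: "h \<in> pverts H" for h
    proof -
      obtain x where x: "x \<in> M h" using connected_in_nonempty[OF con[OF h]] by auto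
      have "M h \<subseteq> {x}"
        by (rule connected_in_subset[OF con[OF h] x]) (use spanning(2)[OF h] in auto)
      with x show ?thesis by auto
    qed
    then obtain b where b: "\<And>h. h \<in> pverts H \<Longrightarrow> M h = {b h}" by metis
    have "inj_on b (pverts H)"
    proof (rule inj_onI)
      fix f g assume "f \<in> pverts H" "g \<in> pverts H" "b f = b g"
      then show "f = g" using disj[of f g] b by auto
    qed
    moreover have "b ` pverts H = pverts G" using spanning(1) sub b by fastforce
    ultimately have "bij_betw b (pverts H) (pverts G)" by (simp add: bij_betw_def)
    moreover have "(b x, b y) \<in> parcs G" if "(x, y) \<in> parcs H" for x y
      using edges[OF that] b that EH by auto
    ultimately show ?thesis by (rule has_minor_spanning_subgraph[OF G H])
  qed
qed

lemma has_minor_card_le: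
  assumes "has_minor G H" "pair_graph G"
  shows "card (pverts H) \<le> card (pverts G)"
proof -
  obtain G' where G': "minor_step\<^sup>*\<^sup>* G G'" "digraph_iso (with_proj H) (with_proj G')"
    using assms(1) by (auto simp: has_minor_def)
  have card_le: "pair_graph G' \<and> card (pverts G') \<le> card (pverts G)"
    using G'(1)
  proof (induct rule: rtranclp_induct)
    case base
    show ?case using assms(2) by simp
  next
    case (step G1 G2)
    have "pverts G2 \<subseteq> pverts G1"
      using step(2) by cases (auto simp: delete_vertex_def delete_edge_def contract_edge_def Let_def)
    then have "card (pverts G2) \<le> card (pverts G1)"
      using step(3) by (intro card_mono) (auto simp: pair_graph_iff)
    then show ?case using step pair_graph_minor_step by auto
  qed
  obtain f where f: "pre_digraph.digraph_isomorphism (with_proj H) f" "with_proj G' = app_iso f (with_proj H)"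
    using G'(2) by (auto simp: digraph_iso_def)
  have "pverts G' = verts (with_proj G')" by simp
  also have "\<dots> = iso_verts f ` pverts H" unfolding f(2) by (simp add: verts_app_iso)
  finally have "pverts G' = iso_verts f ` pverts H" .
  then have "card (pverts G') = card (pverts H)"
    using f(1) by (simp add: pre_digraph.digraph_isomorphism_def card_image)
  then show ?thesis using card_le by simp
qed

section \<open>Apex-forests\<close>

text \<open>
  A forest is an apex-forest with any of its vertices as the apex.
\<close>

lemma apex_forestE:
  assumes "pair_graph H" "pverts H \<noteq> {}" "apex_forest H"
  obtains a where "a \<in> pverts H" "one_degenerate (parcs H) (pverts H - {a})"
proof -
  have "\<exists>a\<in>pverts H. one_degenerate (parcs H) (pverts H - {a})"
  proof (cases "undirected_forest H")
    case True
    then have deg: "one_degenerate (parcs H) (pverts H)" by (simp add: undirected_forest_iff)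
    obtain a where "a \<in> pverts H" using assms(2) by auto
    then show ?thesis using one_degenerate_restrict[OF deg, of "pverts H - {a}" UNIV "parcs H"] by auto
  next
    case False
    then obtain a where a: "a \<in> pverts H" "undirected_forest (delete_vertex H a)"
      using assms(3) by (auto simp: apex_forest_def)
    then have deg: "one_degenerate {e \<in> parcs H. fst e \<noteq> a \<and> snd e \<noteq> a} (pverts H - {a})"
      by (simp add: undirected_forest_iff delete_vertex_def)
    have "one_degenerate (parcs H) (pverts H - {a})"
      by (rule one_degenerate_restrict[OF deg, of _ "- {a}"]) auto
    with a(1) show ?thesis by blast
  qed
  with that show ?thesis by blast
qed

theorem large_treewidth_has_apex_forest_minor:
  assumes H: "pair_graph H" "pverts H \<noteq> {}" "apex_forest H"
    and G: "pair_graph G" "int (card (pverts H)) - 1 \<le> treewidth G"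
  shows "has_minor G H"
proof -
  obtain a where a: "a \<in> pverts H" "one_degenerate (parcs H) (pverts H - {a})"
    by (rule apex_forestE[OF H])
  let ?W = "pverts H - {a}" and ?V = "pverts G" and ?E = "parcs G"
  define w where "w = card ?W"
  have V: "finite ?V" "?E \<subseteq> ?V \<times> ?V" "sym ?E" "irrefl ?E"
    and F: "sym (parcs H)" "irrefl (parcs H)" "finite ?W"
    using G(1) H(1) by (auto simp: pair_graph_iff)
  have w: "card (pverts H) = Suc w" using card.remove[of "pverts H" a] a(1) H(1) by (simp add: w_def pair_graph_iff)
  have "\<exists>\<B>. bramble ?V ?E \<B> \<and> (\<forall>X\<subseteq>?V. card X \<le> w \<longrightarrow> \<not> covers X \<B>)"
  proof (rule ccontr)
    assume *: "\<not> ?thesis"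
    have "\<exists>X\<subseteq>?V. card X \<le> w \<and> covers X \<B>" if "bramble ?V ?E \<B>" for \<B>
      using * that by blast
    from rooted_td_of_small_brambles[OF V this] obtain R \<R> where
      "rooted_td ?E ?V R \<R>" "\<And>Q. Q \<in> \<R> \<Longrightarrow> card Q \<le> w" by blast
    from exists_decomposition[OF G(1) this] obtain T :: "nat pair_pre_digraph" and X where
      "tree_decomposition G T X" "decomposition_width T X \<le> int w - 1" by blast
    then have "treewidth G \<le> int w - 1" using treewidth_least(2)[OF G(1)] by fastforce
    then show False using G(2) w by simp
  qed
  then obtain \<B> where \<B>: "bramble ?V ?E \<B>" "\<And>X. X \<subseteq> ?V \<Longrightarrow> card X \<le> w \<Longrightarrow> \<not> covers X \<B>" by blast
  obtain C M where am: "attached_model ?V ?E \<B> (parcs H) ?W C M"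
    using attached_model_exists[OF V \<B> F(1,2,3) a(2)] w_def by blast
  note am' = am[unfolded attached_model_def branch_sets_def large_def]
  have C: "C \<subseteq> ?V" "connected_in ?E C"
    and M: "\<And>f. f \<in> ?W \<Longrightarrow> connected_in ?E (M f)" "\<And>f. f \<in> ?W \<Longrightarrow> M f \<subseteq> ?V - C"
      "\<And>f. f \<in> ?W \<Longrightarrow> M f \<inter> neighbourhood ?E C \<noteq> {}" "disjoint_family_on M ?W"
      "\<And>f g. f \<in> ?W \<Longrightarrow> g \<in> ?W \<Longrightarrow> (f, g) \<in> parcs H \<Longrightarrow> \<exists>x\<in>M f. \<exists>y\<in>M g. (x, y) \<in> ?E"
    using am' by auto
  have apex_edge: "\<exists>x\<in>C. \<exists>y\<in>M f. (x, y) \<in> ?E \<and> (y, x) \<in> ?E" if f: "f \<in> ?W" for f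
  proof -
    obtain y where "y \<in> M f" "y \<in> neighbourhood ?E C" using M(3)[OF f] by auto
    then show ?thesis using V(3) by (auto simp: neighbourhood_def dest: symD)
  qed
  define N where "N = M(a := C)"
  have N: "N a = C" "\<And>f. f \<in> ?W \<Longrightarrow> N f = M f" by (auto simp: N_def)
  have "branch_sets ?E (parcs H) (pverts H) N"
    unfolding branch_sets_def
  proof (intro conjI ballI impI)
    fix f assume "f \<in> pverts H"
    then show "connected_in ?E (N f)" using C(2) M(1)[of f] by (cases "f = a") (auto simp: N_def)
  next
    have "M f \<inter> C = {}" if "f \<in> ?W" for f using M(2)[OF that] by auto
    then show "disjoint_family_on N (pverts H)"
      using M(4) unfolding disjoint_family_on_def N_def by auto
  next
    fix f g assume fg: "f \<in> pverts H" "g \<in> pverts H" "(f, g) \<in> parcs H"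
    have "f \<noteq> g" using fg(3) F(2) by (auto simp: irrefl_def)
    then consider "f = a" "g \<in> ?W" | "g = a" "f \<in> ?W" | "f \<in> ?W" "g \<in> ?W" using fg by auto
    then show "\<exists>x\<in>N f. \<exists>y\<in>N g. (x, y) \<in> ?E"
    proof cases
      case 1
      then show ?thesis using apex_edge[of g] N(1) N(2)[of g] by auto
    next
      case 2
      then show ?thesis using apex_edge[of f] N(1) N(2)[of f] by auto
    next
      case 3
      then show ?thesis using M(5)[OF _ _ fg(3)] N(2)[of f] N(2)[of g] by auto
    qed
  qed
  moreover have "N f \<subseteq> ?V" if "f \<in> pverts H" for f
    using that C(1) M(2)[of f] by (cases "f = a") (auto simp: N_def)
  ultimately show ?thesis by (rule has_minor_of_branch_sets[OF G(1) H(1)])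
qed

theorem theorem1p1:
  fixes H :: "'a pair_pre_digraph"
  assumes "pair_graph H"
    and "pverts H \<noteq> {}"
    and "apex_forest H"
  shows "(\<forall>G :: 'b pair_pre_digraph.
            pair_graph G \<and> treewidth G \<ge> int (card (pverts H)) - 1 \<longrightarrow> has_minor G H) \<and>
         minor_threshold H = int (card (pverts H)) - 1"
proof
  show "\<forall>G :: 'b pair_pre_digraph.
      pair_graph G \<and> treewidth G \<ge> int (card (pverts H)) - 1 \<longrightarrow> has_minor G H"
    using large_treewidth_has_apex_forest_minor[OF assms] by blast
  show "minor_threshold H = int (card (pverts H)) - 1"
    unfolding minor_threshold_def
  proof (rule Least_equality)
    show "\<forall>G :: nat pair_pre_digraph.
        pair_graph G \<and> int (card (pverts H)) - 1 \<le> treewidth G \<longrightarrow> has_minor G H"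
      using large_treewidth_has_apex_forest_minor[OF assms] by blast
  next
    fix k assume k: "\<forall>G :: nat pair_pre_digraph. pair_graph G \<and> k \<le> treewidth G \<longrightarrow> has_minor G H"
    show "int (card (pverts H)) - 1 \<le> k"
    proof (rule ccontr)
      assume "\<not> ?thesis"
      moreover define m where "m = card (pverts H) - 1"
      moreover have pos: "0 < card (pverts H)" using assms by (simp add: pair_graph_iff card_gt_0_iff)
      ultimately have "k \<le> int m - 1" by simp
      then have "k \<le> treewidth (complete_graph m)" using treewidth_complete_graph[of m] by simp
      then have "has_minor (complete_graph m) H" using k pair_graph_complete_graph by blast
      then have "card (pverts H) \<le> card (pverts (complete_graph m))"
        by (rule has_minor_card_le[OF _ pair_graph_complete_graph])
      then show False using pos by (simp add: complete_graph_def m_def)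
    qed
  qed
qed

end
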